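(* Let $p$ be a prime with $p\equiv 1\pmod 3$, and write $p=x^2+3y^2$ with $x,y\in\mathbb Z$. Then $$\sum_{k=0}^{p-1}\binom{2k}k^2\frac 1{16^k}\cdot\frac p{3k+1}\equiv\sum_{k=0}^{p-1}\binom{2k}k^2\frac 1{16^k}\cdot\frac p{6k+1}\equiv 4x^2-2p\pmod{p^2}.$$
   Context: Congruences are taken in the ring $\mathbb Z_p$ of rational numbers whose denominators are not divisible by $p$. *)

theory Defs
  imports Complex_Main "HOL-Number_Theory.Number_Theory"
begin

(* quotient_of yields the reduced fraction with positive denominator, so this is the
   localization of the integers at the prime p, not the ring of p-adic integers. *)
definition zp_ring :: "nat \<Rightarrow> rat set" where
  "zp_ring p = {r. \<not> int p dvd snd (quotient_of r)}"

(* Congruence modulo the ideal generated by m in zp_ring p; both sides are required to lie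
   in zp_ring p, since the congruence relation is that of this ring. *)
definition zp_cong :: "nat \<Rightarrow> rat \<Rightarrow> rat \<Rightarrow> rat \<Rightarrow> bool" where
  "zp_cong p a b m \<longleftrightarrow>
     a \<in> zp_ring p \<and> b \<in> zp_ring p \<and> (\<exists>c \<in> zp_ring p. a - b = m * c)"

end

theory Submission
  imports Defs "HOL-Computational_Algebra.Formal_Power_Series"
begin

text \<open>
  Write \<open>p = 2n + 1 = 6r + 1\<close> and \<open>H\<close> for harmonic numbers. Modulo \<open>p\<^sup>2\<close> the factor
  \<open>(2k choose k)\<^sup>2 / 16\<^sup>k\<close> is \<open>(-1)\<^sup>k (n choose k) (n + k choose k)\<close> for \<open>k \<le> n\<close>, while the terms with
  \<open>k > n\<close> vanish. By partial fractions each of the two sums therefore becomes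
  \<open>\<Prod>(d j - 1) / \<Prod>(d j + 1)\<close> with \<open>d = 3, 6\<close>, where the factor \<open>p\<close> of the denominator is left out,
  and expanding every factor around a multiple of \<open>p\<close> shows that both are congruent to
  \<open>(n choose 2r)\<^sup>2 (1 + p (2/3 H(2r) + 1/3 H(r) - H(n)))\<close>.

  On the other side, let \<open>J\<^sub>1, J\<^sub>2\<close> be the two conjugate Jacobi sums of the quadratic and the cubic
  characters, realised modulo \<open>p\<^sup>3\<close> by Teichmueller representatives. Then \<open>J\<^sub>1 + J\<^sub>2 = 2X\<close> with
  \<open>p = X\<^sup>2 + 3Y\<^sup>2\<close>, so \<open>X\<^sup>2 = x\<^sup>2\<close>, and \<open>J\<^sub>1 J\<^sub>2 = p\<close> with \<open>p\<close> dividing \<open>J\<^sub>1\<close>; hence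
  \<open>4x\<^sup>2 - 2p\<close> is congruent to \<open>J\<^sub>2\<^sup>2\<close> modulo \<open>p\<^sup>2\<close>. Finally
  \<open>(1 - s)\<^bsup>pn\<^esup>\<close> is congruent to \<open>(1 - s)\<^sup>n (1 - p n \<Sum>H(k) s\<^sup>k)\<close> for a Teichmueller representative \<open>s\<close>, so
  \<open>J\<^sub>2\<close> reduces to the alternating binomial sum of \<open>H(\<bar>2r - i\<bar>)\<close>, which has a closed form.
  Its square is the expression found for the two sums.
\<close>

section \<open>Congruences of \<open>p\<close>-integral rationals\<close>

text \<open>The numerator and denominator of the reduced fraction are coprime, so a prime in the
  reduced denominator survives in every other denominator. Closure proofs can thus use arbitrary
  fractions instead of \<open>quotient_of\<close>.\<close>

lemma zp_ring_iff:
  assumes "prime p"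
  shows "r \<in> zp_ring p \<longleftrightarrow> (\<exists>a b. \<not> int p dvd b \<and> r = of_int a / of_int b)"
proof
  assume "r \<in> zp_ring p"
  then show "\<exists>a b. \<not> int p dvd b \<and> r = of_int a / of_int b"
    unfolding zp_ring_def
    by (metis (no_types, lifting) mem_Collect_eq prod.collapse quotient_of_div)
next
  assume "\<exists>a b. \<not> int p dvd b \<and> r = of_int a / of_int b"
  then obtain a b where b: "\<not> int p dvd b" and r: "r = of_int a / of_int b" by blast
  obtain c d where cd: "quotient_of r = (c, d)" by force
  have d: "d > 0" "coprime c d" and r': "r = of_int c / of_int d"
    using cd quotient_of_denom_pos quotient_of_coprime quotient_of_div by auto
  have "b \<noteq> 0" using b by auto
  with d r r' have "rat_of_int (c * b) = of_int (a * d)"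
    by (simp add: field_simps)
  then have eq: "c * b = a * d" by linarith
  have pp: "prime (int p)" using assms by simp
  have "\<not> int p dvd d"
  proof
    assume pd: "int p dvd d"
    then have "int p dvd c * b" using eq by simp
    then have "int p dvd c" using pp b prime_dvd_mult_iff by blast
    with pd d(2) pp show False
      by (meson coprime_common_divisor not_prime_unit)
  qed
  then show "r \<in> zp_ring p" by (simp add: zp_ring_def cd)
qed

section \<open>Closure properties of the localization\<close>

lemma of_int_in_zp_ring [simp]: "prime p \<Longrightarrow> of_int a \<in> zp_ring p"
  unfolding zp_ring_def by (simp add: prime_gt_1_nat not_le[symmetric]) (use not_prime_1 in auto)

lemma of_nat_in_zp_ring [simp]: "prime p \<Longrightarrow> of_nat a \<in> zp_ring p"
  using of_int_in_zp_ring[of p "int a"] by simp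

lemma zero_in_zp_ring [simp]: "prime p \<Longrightarrow> 0 \<in> zp_ring p"
  and one_in_zp_ring [simp]: "prime p \<Longrightarrow> 1 \<in> zp_ring p"
  and numeral_in_zp_ring [simp]: "prime p \<Longrightarrow> numeral w \<in> zp_ring p"
  using of_int_in_zp_ring[of p 0] of_int_in_zp_ring[of p 1] of_int_in_zp_ring[of p "numeral w"]
  by auto

lemma zp_ring_mult [simp]:
  assumes "prime p" "r \<in> zp_ring p" "s \<in> zp_ring p"
  shows "r * s \<in> zp_ring p"
proof -
  obtain a b c d where "\<not> int p dvd b" "r = of_int a / of_int b"
    "\<not> int p dvd d" "s = of_int c / of_int d"
    using assms zp_ring_iff by meson
  moreover from this have "\<not> int p dvd b * d"
    using assms(1) by (simp add: prime_dvd_mult_iff)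
  moreover have "r * s = of_int (a * c) / of_int (b * d)" using calculation by simp
  ultimately show ?thesis using zp_ring_iff[OF assms(1)] by blast
qed

lemma zp_ring_uminus [simp]:
  assumes "prime p" "r \<in> zp_ring p"
  shows "- r \<in> zp_ring p"
  using zp_ring_mult[OF assms(1) of_int_in_zp_ring[OF assms(1), of "-1"] assms(2)] by simp

lemma zp_ring_add [simp]:
  assumes "prime p" "r \<in> zp_ring p" "s \<in> zp_ring p"
  shows "r + s \<in> zp_ring p"
proof -
  obtain a b c d where *: "\<not> int p dvd b" "r = of_int a / of_int b"
    "\<not> int p dvd d" "s = of_int c / of_int d"
    using assms zp_ring_iff by meson
  moreover from this have "\<not> int p dvd b * d"
    using assms(1) by (simp add: prime_dvd_mult_iff)
  moreover have "b \<noteq> 0" "d \<noteq> 0" using * by auto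
  then have "r + s = of_int (a * d + c * b) / of_int (b * d)"
    using * by (simp add: field_simps)
  ultimately show ?thesis using zp_ring_iff[OF assms(1)] by blast
qed

lemma zp_ring_diff [simp]:
  "prime p \<Longrightarrow> r \<in> zp_ring p \<Longrightarrow> s \<in> zp_ring p \<Longrightarrow> r - s \<in> zp_ring p"
  using zp_ring_add[of p r "- s"] by simp

lemma zp_ring_power [simp]: "prime p \<Longrightarrow> r \<in> zp_ring p \<Longrightarrow> r ^ k \<in> zp_ring p"
  by (induction k) auto

lemma zp_ring_sum:
  "prime p \<Longrightarrow> (\<And>i. i \<in> A \<Longrightarrow> f i \<in> zp_ring p) \<Longrightarrow> sum f A \<in> zp_ring p"
  by (induction A rule: infinite_finite_induct) auto

lemma zp_ring_divide_int:
  assumes "prime p" "r \<in> zp_ring p" "\<not> int p dvd b"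
  shows "r / of_int b \<in> zp_ring p"
proof -
  have "of_int 1 / of_int b \<in> zp_ring p" using zp_ring_iff assms by blast
  from zp_ring_mult[OF assms(1,2) this] show ?thesis by simp
qed

lemma zp_ring_divide_nat:
  assumes "prime p" "r \<in> zp_ring p" "\<not> p dvd b"
  shows "r / of_nat b \<in> zp_ring p"
  using zp_ring_divide_int[OF assms(1,2), of "int b"] assms(3) by simp

text \<open>The exponent is an argument of its own because the proof moves between the moduli
  \<open>p\<close> and \<open>p^2\<close>: a correction that carries a factor \<open>p\<close> has
  to be known only modulo \<open>p\<close>.\<close>

definition pcong :: "nat \<Rightarrow> nat \<Rightarrow> rat \<Rightarrow> rat \<Rightarrow> bool" where
  "pcong p k a b \<longleftrightarrow> zp_cong p a b (of_nat p ^ k)"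

lemma pcongI:
  "prime p \<Longrightarrow> b \<in> zp_ring p \<Longrightarrow> c \<in> zp_ring p \<Longrightarrow> a = b + of_nat p ^ k * c \<Longrightarrow> pcong p k a b"
  unfolding pcong_def zp_cong_def by (auto intro!: bexI[of _ c])

lemma pcongE:
  assumes "pcong p k a b"
  obtains c where "a \<in> zp_ring p" "b \<in> zp_ring p" "c \<in> zp_ring p" "a = b + of_nat p ^ k * c"
  using assms unfolding pcong_def zp_cong_def by (metis add_diff_cancel_left' diff_add_cancel add.commute)

lemma pcong_ring: "pcong p k a b \<Longrightarrow> a \<in> zp_ring p" "pcong p k a b \<Longrightarrow> b \<in> zp_ring p"
  by (auto simp: pcong_def zp_cong_def)

lemma pcong_refl: "prime p \<Longrightarrow> a \<in> zp_ring p \<Longrightarrow> pcong p k a a"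
  by (rule pcongI[of _ _ 0]) auto

lemma pcong_sym:
  assumes "prime p" "pcong p k a b" shows "pcong p k b a"
  using assms(2)
proof (rule pcongE)
  fix c assume "a \<in> zp_ring p" "b \<in> zp_ring p" "c \<in> zp_ring p" "a = b + of_nat p ^ k * c"
  then show ?thesis using assms(1) by (intro pcongI[of _ _ "- c"]) auto
qed

lemma pcong_trans [trans]:
  assumes "pcong p k a b" "pcong p k b c" "prime p" shows "pcong p k a c"
proof -
  obtain d e where "a \<in> zp_ring p" "c \<in> zp_ring p" "d \<in> zp_ring p" "e \<in> zp_ring p"
    "a = b + of_nat p ^ k * d" "b = c + of_nat p ^ k * e"
    using assms by (elim pcongE) blast
  then show ?thesis using assms(3)
    by (intro pcongI[of _ _ "d + e"]) (auto simp: algebra_simps)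
qed

lemma pcong_add:
  assumes "prime p" "pcong p k a b" "pcong p k c d" shows "pcong p k (a + c) (b + d)"
proof -
  obtain e f where "b \<in> zp_ring p" "d \<in> zp_ring p" "e \<in> zp_ring p" "f \<in> zp_ring p"
    "a = b + of_nat p ^ k * e" "c = d + of_nat p ^ k * f"
    using assms by (elim pcongE) blast
  then show ?thesis using assms(1)
    by (intro pcongI[of _ _ "e + f"]) (auto simp: algebra_simps)
qed

lemma pcong_mult:
  assumes "prime p" "pcong p k a b" "pcong p k c d" shows "pcong p k (a * c) (b * d)"
proof -
  obtain e f where "b \<in> zp_ring p" "c \<in> zp_ring p" "d \<in> zp_ring p" "e \<in> zp_ring p" "f \<in> zp_ring p"
    "a = b + of_nat p ^ k * e" "c = d + of_nat p ^ k * f"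
    using assms by (elim pcongE) blast
  then show ?thesis using assms(1)
    by (intro pcongI[of _ _ "e * c + b * f"]) (auto simp: algebra_simps)
qed

lemma pcong_uminus:
  assumes "prime p" "pcong p k a b" shows "pcong p k (- a) (- b)"
  using pcong_mult[OF assms(1) pcong_refl[of p "-1"] assms(2)] assms(1) by simp

lemma pcong_diff:
  assumes "prime p" "pcong p k a b" "pcong p k c d" shows "pcong p k (a - c) (b - d)"
  using pcong_add[OF assms(1,2) pcong_uminus[OF assms(1,3)]] by simp

lemma pcong_power:
  "prime p \<Longrightarrow> pcong p k a b \<Longrightarrow> pcong p k (a ^ m) (b ^ m)"
  by (induction m) (auto intro: pcong_mult pcong_refl)

lemma pcong_sum:
  "prime p \<Longrightarrow> (\<And>i. i \<in> A \<Longrightarrow> pcong p k (f i) (g i)) \<Longrightarrow> pcong p k (sum f A) (sum g A)"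
  by (induction A rule: infinite_finite_induct) (auto intro: pcong_add pcong_refl)

lemma pcong_prod:
  "prime p \<Longrightarrow> (\<And>i. i \<in> A \<Longrightarrow> pcong p k (f i) (g i)) \<Longrightarrow> pcong p k (prod f A) (prod g A)"
  by (induction A rule: infinite_finite_induct) (auto intro: pcong_mult pcong_refl)

lemma pcong_of_int:
  assumes "prime p" "[a = b] (mod int p ^ k)" shows "pcong p k (of_int a) (of_int b)"
proof -
  obtain c where "a = b + int p ^ k * c"
    using cong_sym[OF assms(2)] by (auto simp: cong_iff_lin)
  then show ?thesis using assms(1) by (intro pcongI[of _ _ "of_int c"]) auto
qed

lemma pcong_mult_p:
  assumes "prime p" "pcong p k a b" shows "pcong p (Suc k) (of_nat p * a) (of_nat p * b)"
  using assms(2)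
proof (rule pcongE)
  fix c assume "a \<in> zp_ring p" "b \<in> zp_ring p" "c \<in> zp_ring p" "a = b + of_nat p ^ k * c"
  then show ?thesis using assms(1) by (intro pcongI[of _ _ c]) (auto simp: algebra_simps)
qed

lemma pcong_le:
  assumes "prime p" "pcong p k a b" "l \<le> k" shows "pcong p l a b"
  using assms(2)
proof (rule pcongE)
  fix c assume "a \<in> zp_ring p" "b \<in> zp_ring p" "c \<in> zp_ring p" "a = b + of_nat p ^ k * c"
  then show ?thesis using assms(1,3)
    by (intro pcongI[of _ _ "of_nat p ^ (k - l) * c"]) (auto simp: mult.assoc[symmetric] simp flip: power_add)
qed

lemma pcong_p_zero: "prime p \<Longrightarrow> a \<in> zp_ring p \<Longrightarrow> pcong p k (of_nat p ^ k * a) 0"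
  by (rule pcongI[of _ _ a]) auto

text \<open>Membership of \<open>a\<close> and \<open>b\<close> is assumed because
  \<open>p * a\<close> may be \<open>p\<close>-integral when \<open>a\<close> is not.\<close>

lemma pcong_cancel_p:
  assumes "prime p" "pcong p 2 (of_nat p * a) (of_nat p * b)" "a \<in> zp_ring p" "b \<in> zp_ring p"
  shows "pcong p 1 a b"
  using assms(2)
proof (rule pcongE)
  fix c assume c: "c \<in> zp_ring p" "of_nat p * a = of_nat p * b + of_nat p ^ 2 * c"
  have "(of_nat p :: rat) \<noteq> 0" using assms(1) by auto
  then have "a = b + of_nat p ^ 1 * c" using c(2) by (simp add: power2_eq_square mult.assoc flip: distrib_left)
  then show ?thesis using c assms by (intro pcongI)
qed

section \<open>First-order expansions modulo \<open>p^2\<close>\<close>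

lemma pcong_one_plus_mult:
  assumes "prime p" "pcong p 2 a (1 + of_nat p * u)" "pcong p 2 b (1 + of_nat p * v)"
    "u \<in> zp_ring p" "v \<in> zp_ring p"
  shows "pcong p 2 (a * b) (1 + of_nat p * (u + v))"
proof -
  have "pcong p 2 (a * b) ((1 + of_nat p * u) * (1 + of_nat p * v))"
    using assms by (intro pcong_mult)
  also have "pcong p 2 \<dots> (1 + of_nat p * (u + v))"
    using assms by (intro pcongI[of _ _ "u * v"]) (auto simp: power2_eq_square algebra_simps)
  finally show ?thesis using assms(1) by blast
qed

text \<open>All cross terms carry \<open>p^2\<close>, so the product linearises. Taking
  \<open>u i\<close> as a multiple of \<open>1 / i\<close> is how harmonic numbers enter.\<close>

lemma pcong_prod_one_plus:
  assumes "prime p" "finite A" "\<And>i. i \<in> A \<Longrightarrow> u i \<in> zp_ring p"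
  shows "pcong p 2 (\<Prod>i\<in>A. 1 + of_nat p * u i) (1 + of_nat p * (\<Sum>i\<in>A. u i))"
  using assms(2,3)
proof (induction A rule: finite_induct)
  case (insert x A)
  have "pcong p 2 ((1 + of_nat p * u x) * (\<Prod>i\<in>A. 1 + of_nat p * u i)) (1 + of_nat p * (u x + (\<Sum>i\<in>A. u i)))"
    using assms(1) insert
    by (intro pcong_one_plus_mult) (auto intro!: pcong_refl zp_ring_sum)
  then show ?case using insert by simp
qed (use assms(1) in \<open>auto intro: pcong_refl\<close>)

text \<open>Modulo \<open>p^2\<close> the factor \<open>1 - p * u\<close> is an inverse of
  \<open>1 + p * u\<close>; multiplying the exact equation by it isolates \<open>A\<close> without
  dividing by \<open>X\<close>.\<close>

lemma pcong_solve_one_plus: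
  assumes "prime p" "A \<in> zp_ring p" "c \<in> zp_ring p" "u \<in> zp_ring p" "v \<in> zp_ring p"
    "A * X = c * Y" "pcong p 2 X (1 + of_nat p * u)" "pcong p 2 Y (1 + of_nat p * v)"
  shows "pcong p 2 A (c * (1 + of_nat p * (v - u)))"
proof -
  have X: "pcong p 2 (X * (1 - of_nat p * u)) (1 + of_nat p * (u + (- u)))"
    using assms by (intro pcong_one_plus_mult) (auto intro: pcong_refl)
  have Y: "pcong p 2 (Y * (1 - of_nat p * u)) (1 + of_nat p * (v + (- u)))"
    using assms by (intro pcong_one_plus_mult) (auto intro: pcong_refl)
  have "pcong p 2 (A * (X * (1 - of_nat p * u))) A"
    using pcong_mult[OF assms(1) pcong_refl[OF assms(1,2)] X] by simp
  then have "pcong p 2 A (A * (X * (1 - of_nat p * u)))"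
    using pcong_sym assms(1) by blast
  also have "A * (X * (1 - of_nat p * u)) = c * (Y * (1 - of_nat p * u))"
    using assms(6) by (metis mult.assoc)
  also have "pcong p 2 \<dots> (c * (1 + of_nat p * (v + (- u))))"
    using pcong_mult[OF assms(1) pcong_refl[OF assms(1,3)] Y] .
  finally show ?thesis using assms(1) by simp
qed

section \<open>Binomial sums with harmonic numbers\<close>

definition hsum :: "nat \<Rightarrow> rat" where
  "hsum k = (\<Sum>j=1..k. 1 / of_nat j)"

lemma hsum_0 [simp]: "hsum 0 = 0"
  and hsum_Suc: "hsum (Suc k) = hsum k + 1 / of_nat (Suc k)"
  by (auto simp: hsum_def)

text \<open>Pascal's rule, followed by a shift of the index: one order of the alternating sum is
  traded for one difference of \<open>f\<close>.\<close>

lemma alternating_binomial_sum_Suc: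
  fixes f :: "nat \<Rightarrow> 'a :: comm_ring_1"
  shows "(\<Sum>i\<le>Suc n. (-1) ^ i * of_nat (Suc n choose i) * f i)
       = (\<Sum>i\<le>n. (-1) ^ i * of_nat (n choose i) * (f i - f (Suc i)))"
proof -
  have "(\<Sum>i\<le>n. (-1) ^ i * of_nat (n choose i) * f i)
      = (\<Sum>i\<le>Suc n. (-1) ^ i * of_nat (n choose i) * f i)" by (simp add: binomial_eq_0)
  also have "\<dots> = f 0 + (\<Sum>i\<le>n. (-1) ^ Suc i * of_nat (n choose Suc i) * f (Suc i))"
    by (subst sum.atMost_Suc_shift) simp
  finally have *: "(\<Sum>i\<le>n. (-1) ^ i * of_nat (n choose i) * f i)
    = f 0 + (\<Sum>i\<le>n. (-1) ^ Suc i * of_nat (n choose Suc i) * f (Suc i))" .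
  have "(\<Sum>i\<le>Suc n. (-1) ^ i * of_nat (Suc n choose i) * f i)
      = f 0 + (\<Sum>i\<le>n. (-1) ^ Suc i * of_nat (Suc n choose Suc i) * f (Suc i))"
    by (subst sum.atMost_Suc_shift) simp
  also have "\<dots> = f 0 + (\<Sum>i\<le>n. (-1) ^ Suc i * of_nat (n choose Suc i) * f (Suc i))
      - (\<Sum>i\<le>n. (-1) ^ i * of_nat (n choose i) * f (Suc i))"
    by (simp add: algebra_simps sum.distrib sum_negf sum_subtractf)
  also have "\<dots> = (\<Sum>i\<le>n. (-1) ^ i * of_nat (n choose i) * (f i - f (Suc i)))"
    by (subst *[symmetric]) (simp add: algebra_simps sum_subtractf)
  finally show ?thesis .
qed

text \<open>The \<open>n\<close>-th backward difference at \<open>q\<close> of the even function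
  sending an integer \<open>j\<close> to \<open>hsum\<close> of its absolute value. It arises as the
  term of order \<open>p\<close> in the Jacobi sum.\<close>

definition binomial_hsum :: "nat \<Rightarrow> nat \<Rightarrow> rat" where
  "binomial_hsum n q = (\<Sum>i\<le>n. (-1) ^ i * of_nat (n choose i) * hsum (nat \<bar>int q - int i\<bar>))"

lemma binomial_hsum_Suc_Suc:
  "binomial_hsum (Suc n) (Suc q) = binomial_hsum n (Suc q) - binomial_hsum n q"
  unfolding binomial_hsum_def
  by (subst alternating_binomial_sum_Suc) (simp add: algebra_simps sum_subtractf)

text \<open>One difference turns \<open>hsum\<close> into \<open>- 1 / (i + 1)\<close>; absorption
  moves this into the binomial coefficient, leaving the vanishing alternating row sum without its
  first term.\<close>

lemma binomial_hsum_0: "binomial_hsum (Suc n) 0 = - 1 / of_nat (Suc n)"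
proof -
  have "binomial_hsum (Suc n) 0
      = (\<Sum>i\<le>n. (-1) ^ i * of_nat (n choose i) * (- 1 / of_nat (Suc i)))"
    unfolding binomial_hsum_def by (subst alternating_binomial_sum_Suc) (simp add: hsum_Suc nat_add_distrib)
  also have "\<dots> = (\<Sum>i\<le>n. (-1) ^ Suc i * of_nat (Suc n choose Suc i) / of_nat (Suc n))"
  proof (rule sum.cong)
    fix i
    have "rat_of_nat (Suc i * (Suc n choose Suc i)) = of_nat (Suc n * (n choose i))"
      by (simp only: Suc_times_binomial)
    then have "of_nat (n choose i) / rat_of_nat (Suc i) = of_nat (Suc n choose Suc i) / of_nat (Suc n)"
      unfolding of_nat_mult by (simp add: divide_simps mult.commute del: binomial_Suc_Suc)
    then have "(-1) ^ Suc i * (of_nat (n choose i) / rat_of_nat (Suc i))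
       = (-1) ^ Suc i * (of_nat (Suc n choose Suc i) / of_nat (Suc n))" by (simp only:)
    then show "(-1) ^ i * of_nat (n choose i) * (- 1 / rat_of_nat (Suc i))
       = (-1) ^ Suc i * of_nat (Suc n choose Suc i) / of_nat (Suc n)"
      by (simp del: binomial_Suc_Suc of_nat_Suc)
  qed simp
  also have "\<dots> = (\<Sum>i\<le>n. (-1) ^ Suc i * of_nat (Suc n choose Suc i)) / of_nat (Suc n)"
    by (simp only: sum_divide_distrib)
  also have "(\<Sum>i\<le>n. (-1) ^ Suc i * rat_of_nat (Suc n choose Suc i)) = -1"
  proof -
    have "(\<Sum>i\<le>Suc n. (-1) ^ i * rat_of_nat (Suc n choose i)) = 0"
      by (rule choose_alternating_sum) simp
    then show ?thesis
      unfolding sum.atMost_Suc_shift by (simp add: add_eq_0_iff2 del: binomial_Suc_Suc)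
  qed
  finally show ?thesis by simp
qed

text \<open>Replacing \<open>i\<close> by \<open>n - i\<close> changes only the sign.\<close>

lemma binomial_hsum_self: "binomial_hsum n n = (-1) ^ n * binomial_hsum n 0"
  unfolding binomial_hsum_def sum_distrib_left
  by (rule sum.reindex_bij_witness[of _ "\<lambda>i. n - i" "\<lambda>i. n - i"])
     (auto simp: binomial_symmetric[symmetric] power_diff_conv_inverse of_nat_diff
        minus_one_power_iff simp flip: power_add mult.assoc)

text \<open>Induction on \<open>n\<close> through \<open>binomial_hsum_Suc_Suc\<close>. That
  recurrence reaches the interior values of \<open>q\<close> only, so the two ends \<open>0\<close>
  and \<open>Suc n\<close> come from the preceding lemmas.\<close>

lemma binomial_hsum_eq:
  assumes "0 < n" "q \<le> n"
  shows "of_nat n * binomial_hsum n q = (-1) ^ q * of_nat (n choose q) *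
    (of_nat q * hsum q + of_nat (n - q) * hsum (n - q) - of_nat n * hsum n - 1)"
  using assms
proof (induction n arbitrary: q)
  case (Suc n)
  consider "q = 0" | "q = Suc n" | m where "q = Suc m" "m < n"
    using Suc.prems by (cases q) (auto simp: le_less)
  then show ?case
  proof cases
    case 1
    then show ?thesis by (simp add: binomial_hsum_0 del: of_nat_Suc)
  next
    case 2
    then show ?thesis by (simp add: binomial_hsum_self binomial_hsum_0 del: of_nat_Suc)
  next
    case (3 a)
    define b where "b = n - a"
    have b: "n = a + b" "b > 0" using 3 by (auto simp: b_def)
    then obtain c where c: "b = Suc c" by (cases b) auto
    define C :: rat where "C = of_nat (Suc n choose Suc a)"
    let ?N = "rat_of_nat (Suc n)"
    have "rat_of_nat (Suc a * (Suc n choose Suc a)) = of_nat (Suc n * (n choose a))"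
      by (simp only: Suc_times_binomial)
    then have C1: "?N * of_nat (n choose a) = of_nat (Suc a) * C"
      by (simp only: C_def of_nat_mult)
    have C2: "?N * of_nat (n choose Suc a) = of_nat b * C"
    proof -
      have "C = of_nat (n choose a) + of_nat (n choose Suc a)" by (simp add: C_def)
      then have "?N * of_nat (n choose Suc a) = ?N * C - ?N * of_nat (n choose a)"
        by (simp add: algebra_simps)
      also have "\<dots> = ?N * C - of_nat (Suc a) * C" by (simp only: C1)
      also have "?N * C = of_nat (Suc a) * C + of_nat b * C" by (simp add: b algebra_simps)
      finally show ?thesis by simp
    qed
    have nN: "rat_of_nat n \<noteq> 0" "?N \<noteq> 0" using b by auto
    have i1: "of_nat n * binomial_hsum n (Suc a) = (-1) ^ Suc a * of_nat (n choose Suc a) *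
      (of_nat (Suc a) * hsum (Suc a) + of_nat c * hsum c - of_nat n * hsum n - 1)"
      using Suc.IH[of "Suc a"] b c by simp
    have i2: "of_nat n * binomial_hsum n a = (-1) ^ a * of_nat (n choose a) *
      (of_nat a * hsum a + of_nat b * hsum b - of_nat n * hsum n - 1)"
      using Suc.IH[of a] b c by simp
    \<comment> \<open>\<open>h1\<close> to \<open>h3\<close> move the harmonic numbers of the
      induction hypotheses to the indices \<open>Suc a\<close>, \<open>b\<close> and
      \<open>Suc n\<close> of the claim; only rational terms are left to balance.\<close>
    have h1: "rat_of_nat a * hsum a = of_nat a * hsum (Suc a) - of_nat a / of_nat (Suc a)"
      by (simp add: hsum_Suc algebra_simps)
    have h2: "rat_of_nat c * hsum c = of_nat c * hsum b - of_nat c / of_nat b"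
      by (simp add: hsum_Suc c algebra_simps)
    have h3: "rat_of_nat n * hsum n = of_nat n * hsum (Suc n) - of_nat n / ?N"
      by (simp add: hsum_Suc algebra_simps)
    have "?N * (of_nat n * binomial_hsum (Suc n) (Suc a)) =
        (-1) ^ Suc a * ((?N * of_nat (n choose Suc a)) *
          (of_nat (Suc a) * hsum (Suc a) + of_nat c * hsum c - of_nat n * hsum n - 1)
        + (?N * of_nat (n choose a)) *
          (of_nat a * hsum a + of_nat b * hsum b - of_nat n * hsum n - 1))"
      unfolding binomial_hsum_Suc_Suc right_diff_distrib i1 i2 by (simp add: algebra_simps)
    also have "\<dots> = (-1) ^ Suc a * C * (of_nat b *
          (of_nat (Suc a) * hsum (Suc a) + of_nat c * hsum c - of_nat n * hsum n - 1)
        + of_nat (Suc a) *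
          (of_nat a * hsum a + of_nat b * hsum b - of_nat n * hsum n - 1))"
      unfolding C1 C2 by (simp only: algebra_simps)
    also have "of_nat b *
          (of_nat (Suc a) * hsum (Suc a) + of_nat c * hsum c - of_nat n * hsum n - 1)
        + of_nat (Suc a) *
          (of_nat a * hsum a + of_nat b * hsum b - of_nat n * hsum n - 1)
        = of_nat n * (of_nat (Suc a) * hsum (Suc a) + of_nat b * hsum b - ?N * hsum (Suc n) - 1)"
    proof -
      define x y z w where "x = hsum (Suc a)" "y = hsum b" "z = hsum (Suc n)" "w = rat_of_nat a"
      define v where "v = rat_of_nat c"
      have *: "of_nat (Suc a) = w + 1" "of_nat b = v + 1" "of_nat n = w + v + 1" "?N = w + v + 2"
        "of_nat c = v" "of_nat a = w"
        by (auto simp: b c x_y_z_w_def v_def)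
      have pos: "w + 1 \<noteq> 0" "v + 1 \<noteq> 0" "w + v + 2 \<noteq> 0"
        unfolding *[symmetric] by (auto simp: b c)
      have e: "(v + 1) * (v / (v + 1)) = v" "(w + 1) * (w / (w + 1)) = w"
        "(w + v + 2) * ((w + v + 1) / (w + v + 2)) = w + v + 1" using pos by auto
      \<comment> \<open>The quotients become atoms, which makes the next identity polynomial;
        \<open>e\<close> then removes them.\<close>
      define A B D where "A = v / (v + 1)" "B = w / (w + 1)" "D = (w + v + 1) / (w + v + 2)"
      note ABD = A_B_D_def[symmetric]
      have "(v + 1) * ((w + 1) * x + (v * y - A) - ((w + v + 1) * z - D) - 1)
         + (w + 1) * ((w * x - B) + (v + 1) * y - ((w + v + 1) * z - D) - 1)
        = (v + 1) * (w + 1) * x + (v + 1) * v * y - (v + 1) * A - (w + v + 2) * (w + v + 1) * z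
          + (w + v + 2) * D - (w + v + 2)
          + (w + 1) * w * x - (w + 1) * B + (w + 1) * (v + 1) * y"
        by (simp add: algebra_simps)
      also have "\<dots> = (w + v + 1) * ((w + 1) * x + (v + 1) * y - (w + v + 2) * z - 1)"
        unfolding e[unfolded ABD] by (simp add: algebra_simps)
      finally show ?thesis
        unfolding h1 h2 h3 unfolding x_y_z_w_def(1,2,3)[symmetric] unfolding * ABD .
    qed
    finally have "of_nat n * (?N * binomial_hsum (Suc n) (Suc a)) = of_nat n * ((-1) ^ Suc a * C *
        (of_nat (Suc a) * hsum (Suc a) + of_nat b * hsum b - ?N * hsum (Suc n) - 1))"
      by (simp only: mult.left_commute mult.commute)
    then have "?N * binomial_hsum (Suc n) (Suc a) = (-1) ^ Suc a * C *
        (of_nat (Suc a) * hsum (Suc a) + of_nat b * hsum b - ?N * hsum (Suc n) - 1)"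
      using nN(1) mult_left_cancel by blast
    then show ?thesis by (simp only: 3 C_def b_def diff_Suc_Suc)
  qed
qed simp

text \<open>Vandermonde's convolution with the negative upper index \<open>- n - 1\<close>, for
  which \<open>gchoose\<close> produces the signed \<open>n + k choose k\<close>; the total upper
  index is \<open>- 1\<close>.\<close>

lemma sum_binomial_binomial_alternating:
  "(\<Sum>k\<le>n. (-1) ^ k * rat_of_nat (n choose k) * of_nat (n + k choose k)) = (-1) ^ n"
proof -
  have *: "(- of_nat n - 1 :: rat) gchoose k = (-1) ^ k * of_nat (n + k choose k)" for k
    using gbinomial_negated_upper[of "- of_nat n - 1 :: rat" k]
      binomial_gbinomial[of "n + k" k, where 'a = rat] by (simp add: add.commute)
  have "(\<Sum>k=0..n. ((- of_nat n - 1 :: rat) gchoose k) * (of_nat n gchoose (n - k)))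
     = (- of_nat n - 1 + of_nat n) gchoose n"
    by (rule gbinomial_Vandermonde)
  also have "\<dots> = (-1) ^ n" by (simp add: gbinomial_negated_upper[of "-1"]
    binomial_gbinomial[symmetric])
  also have "(\<Sum>k=0..n. ((- of_nat n - 1 :: rat) gchoose k) * (of_nat n gchoose (n - k)))
    = (\<Sum>k\<le>n. (-1) ^ k * rat_of_nat (n choose k) * of_nat (n + k choose k))"
    by (intro sum.cong) (auto simp: * binomial_gbinomial[symmetric] binomial_symmetric[symmetric])
  finally show ?thesis .
qed

text \<open>The sum is the partial fraction expansion in \<open>z\<close> of the quotient of the two
  products. It satisfies the first-order recurrence \<open>rec\<close> in \<open>n\<close>, which
  appends one factor to each product.\<close>

lemma partial_fraction_binomial:
  fixes z :: rat
  assumes "\<And>j. j \<le> n \<Longrightarrow> of_nat j + z \<noteq> 0"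
  shows "(\<Sum>k\<le>n. (-1) ^ k * of_nat (n choose k) * of_nat (n + k choose k) / (of_nat k + z))
     * (\<Prod>j\<le>n. of_nat j + z) = (\<Prod>j=1..n. of_nat j - z)"
  using assms
proof (induction n)
  case (Suc n)
  define c where "c m k = (-1) ^ k * rat_of_nat (m choose k) * of_nat (m + k choose k)" for m k
  define F where "F m = (\<Sum>k\<le>m. c m k / (of_nat k + z))" for m
  let ?N = "rat_of_nat (Suc n)"
  \<comment> \<open>The ratio of consecutive coefficients is \<open>(?N + k) / (?N - k)\<close>; it
    is stated without division so that it includes \<open>k = Suc n\<close>, where both sides
    vanish.\<close>
  have c: "c (Suc n) k * (?N - of_nat k) = c n k * (?N + of_nat k)" if "k \<le> Suc n" for k
  proof -
    have 1: "(?N - of_nat k) * of_nat (Suc n choose k) = ?N * rat_of_nat (n choose k)"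
    proof (cases k)
      case (Suc m)
      have "rat_of_nat (Suc m * (Suc n choose Suc m)) = of_nat (Suc n * (n choose m))"
        by (simp only: Suc_times_binomial)
      then show ?thesis unfolding Suc by (simp add: algebra_simps)
    qed simp
    have "Suc n * (Suc (n + k) choose Suc n) = Suc (n + k) * (n + k choose n)"
      by (rule Suc_times_binomial)
    moreover have "Suc (n + k) choose Suc n = Suc n + k choose k"
      by (subst binomial_symmetric) auto
    moreover have "n + k choose n = n + k choose k"
      by (subst binomial_symmetric) auto
    ultimately have "rat_of_nat (Suc n * (Suc n + k choose k)) = of_nat (Suc (n + k) * (n + k choose k))"
      by metis
    then have 2: "?N * of_nat (Suc n + k choose k) = (?N + of_nat k) * rat_of_nat (n + k choose k)"
      unfolding of_nat_mult by (simp add: algebra_simps del: binomial_Suc_Suc)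
    have "?N * (c (Suc n) k * (?N - of_nat k)) =
      (-1) ^ k * ((?N - of_nat k) * of_nat (Suc n choose k)) * (?N * of_nat (Suc n + k choose k))"
      unfolding c_def by (simp only: mult_ac)
    also have "\<dots> = ?N * (c n k * (?N + of_nat k))"
      unfolding 1 2 c_def by (simp only: mult_ac)
    finally show ?thesis by (simp del: of_nat_Suc)
  qed
  have nz: "of_nat k + z \<noteq> 0" if "k \<le> Suc n" for k using Suc.prems that by blast
  \<comment> \<open>Here \<open>(?N + z) / (k + z) = 1 + (?N - k) / (k + z)\<close> splits off a
    plain sum of coefficients. After \<open>c\<close> is applied,
    \<open>(?N + k) / (k + z) - 1 = (?N - z) / (k + z)\<close> reassembles
    \<open>F n\<close>.\<close>
  have "F (Suc n) * (?N + z) = (\<Sum>k\<le>Suc n. c (Suc n) k + c (Suc n) k * (?N - of_nat k) / (of_nat k + z))"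
    unfolding F_def sum_distrib_right
    by (intro sum.cong refl) (use nz in \<open>simp add: field_simps\<close>)
  also have "\<dots> = (-1) ^ Suc n + (\<Sum>k\<le>Suc n. c n k * (?N + of_nat k) / (of_nat k + z))"
  proof -
    have "(\<Sum>k\<le>Suc n. c (Suc n) k) = (-1) ^ Suc n"
      unfolding c_def by (rule sum_binomial_binomial_alternating)
    moreover have "(\<Sum>k\<le>Suc n. c (Suc n) k * (?N - of_nat k) / (of_nat k + z))
        = (\<Sum>k\<le>Suc n. c n k * (?N + of_nat k) / (of_nat k + z))"
      by (intro sum.cong refl) (simp only: c atMost_iff)
    ultimately show ?thesis by (simp only: sum.distrib)
  qed
  also have "(\<Sum>k\<le>Suc n. c n k * (?N + of_nat k) / (of_nat k + z))
      = (\<Sum>k\<le>n. c n k * (?N + of_nat k) / (of_nat k + z))"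
    by (simp add: c_def)
  also have "(-1) ^ Suc n = - (\<Sum>k\<le>n. c n k)"
    using sum_binomial_binomial_alternating[of n] by (simp add: c_def)
  also have "- (\<Sum>k\<le>n. c n k) + (\<Sum>k\<le>n. c n k * (?N + of_nat k) / (of_nat k + z))
      = F n * (?N - z)"
    unfolding F_def sum_distrib_right sum_negf[symmetric] sum.distrib[symmetric]
    by (intro sum.cong refl) (use nz in \<open>simp add: field_simps\<close>)
  finally have rec: "F (Suc n) * (?N + z) = F n * (?N - z)" .
  have IH: "F n * (\<Prod>j\<le>n. of_nat j + z) = (\<Prod>j=1..n. of_nat j - z)"
    using Suc.IH Suc.prems by (simp add: F_def c_def)
  have "F (Suc n) * (\<Prod>j\<le>Suc n. of_nat j + z) = (F (Suc n) * (?N + z)) * (\<Prod>j\<le>n. of_nat j + z)"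
    by (simp add: mult_ac)
  also have "\<dots> = F n * (\<Prod>j\<le>n. of_nat j + z) * (?N - z)"
    unfolding rec by (simp only: mult_ac)
  also have "\<dots> = (\<Prod>j=1..Suc n. of_nat j - z)"
    unfolding IH by simp
  finally show ?case unfolding F_def c_def .
qed (use assms in \<open>auto\<close>)

section \<open>The sums modulo \<open>p\<^sup>2\<close>\<close>

lemma hsum_in_zp_ring: "prime p \<Longrightarrow> k < p \<Longrightarrow> hsum k \<in> zp_ring p"
  unfolding hsum_def
  by (intro zp_ring_sum zp_ring_divide_nat) (auto dest: dvd_imp_le)

text \<open>Each factor \<open>(p - j) / j\<close> of the binomial coefficient is
  \<open>- (1 - p / j)\<close>, so the sign cancels and the product linearises.\<close>

lemma binomial_pred_prime:
  assumes "prime p" "k < p"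
  shows "pcong p 2 ((-1) ^ k * of_nat (p - 1 choose k)) (1 + of_nat p * (- hsum k))"
proof -
  have "(-1) ^ k * rat_of_nat (p - 1 choose k) = (\<Prod>j=1..k. 1 + of_nat p * (- 1 / of_nat j))"
    using assms(2)
  proof (induction k)
    case (Suc k)
    have "(p - 1) * (p - 1 - 1 choose k) = Suc k * (p - 1 choose Suc k)"
      by (rule binomial_absorption[symmetric])
    moreover have "(p - 1 - k) * (p - 1 choose k) = (p - 1) * (p - 1 - 1 choose k)"
      by (rule binomial_absorb_comp)
    ultimately have "rat_of_nat (Suc k * (p - 1 choose Suc k)) = of_nat ((p - 1 - k) * (p - 1 choose k))"
      by metis
    moreover have "rat_of_nat (p - 1 - k) = of_nat p - of_nat (Suc k)"
      using Suc.prems by (simp add: of_nat_diff)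
    ultimately have 1: "of_nat (Suc k) * rat_of_nat (p - 1 choose Suc k)
      = (of_nat p - of_nat (Suc k)) * of_nat (p - 1 choose k)" by (simp only: of_nat_mult)
    have nz: "rat_of_nat (Suc k) \<noteq> 0" by (simp del: of_nat_Suc)
    have "rat_of_nat (p - 1 choose Suc k)
        = (of_nat (Suc k) * rat_of_nat (p - 1 choose Suc k)) / of_nat (Suc k)" using nz by simp
    also have "\<dots> = - (1 + of_nat p * (- 1 / of_nat (Suc k))) * of_nat (p - 1 choose k)"
      unfolding 1 using nz by (simp add: field_simps del: of_nat_Suc)
    finally have 2: "rat_of_nat (p - 1 choose Suc k)
        = - (1 + of_nat p * (- 1 / of_nat (Suc k))) * of_nat (p - 1 choose k)" .
    have "(-1) ^ Suc k * rat_of_nat (p - 1 choose Suc k)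
       = ((-1) ^ k * rat_of_nat (p - 1 choose k)) * (1 + of_nat p * (- 1 / of_nat (Suc k)))"
      unfolding 2 by (simp only: power_Suc mult_minus1 mult_minus_left mult_minus_right minus_minus mult_ac)
    then show ?case using Suc by (simp only: prod.nat_ivl_Suc' le_simps Suc_lessD) (simp only: mult_ac)
  qed simp
  also have "pcong p 2 \<dots> (1 + of_nat p * (\<Sum>j=1..k. - 1 / of_nat j))"
    using assms by (intro pcong_prod_one_plus zp_ring_divide_nat) (auto dest: dvd_imp_le)
  also have "(\<Sum>j=1..k. - 1 / rat_of_nat j) = - hsum k"
    by (simp add: hsum_def sum_negf)
  finally show ?thesis .
qed

text \<open>The symmetry of \<open>p - 1 choose k\<close>, read off in the coefficient of
  \<open>p\<close> of \<open>binomial_pred_prime\<close>. The signs agree because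
  \<open>p - 1\<close> is even.\<close>

lemma hsum_reflect:
  assumes "prime p" "odd p" "k < p"
  shows "pcong p 1 (hsum (p - 1 - k)) (hsum k)"
proof -
  have k: "k \<le> p - 1" "p - 1 - k < p" using assms by auto
  have "even (p - 1)" using assms by simp
  then have s: "(-1::rat) ^ (p - 1 - k) = (-1) ^ k" using k assms(3) by (auto simp: minus_one_power_iff)
  have "(-1) ^ (p - 1 - k) * rat_of_nat (p - 1 choose (p - 1 - k)) = (-1) ^ k * of_nat (p - 1 choose k)"
    unfolding s binomial_symmetric[OF k(1)] ..
  then have "pcong p 2 (1 + of_nat p * (- hsum (p - 1 - k))) (1 + of_nat p * (- hsum k))"
    using binomial_pred_prime[OF assms(1,3)] binomial_pred_prime[OF assms(1) k(2)]
      pcong_sym pcong_trans assms(1) by metis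
  from pcong_diff[OF assms(1) pcong_refl[OF assms(1) one_in_zp_ring[OF assms(1)]] this]
  have "pcong p 2 (of_nat p * hsum (p - 1 - k)) (of_nat p * hsum k)" by simp
  then show ?thesis using hsum_in_zp_ring[OF assms(1)] assms k by (intro pcong_cancel_p) auto
qed

section \<open>Central binomial coefficients modulo \<open>p^2\<close>\<close>

lemma central_binomial_prod:
  "(rat_of_nat ((2 * k) choose k))\<^sup>2 * (1 / 16 ^ k) = (\<Prod>j=1..k. (2 * of_nat j - 1)\<^sup>2 / (2 * of_nat j)\<^sup>2)"
proof (induction k)
  case (Suc k)
  define B where "B = rat_of_nat ((2 * k) choose k)"
  have "Suc k * (Suc (Suc (2 * k)) choose Suc k) = Suc (Suc (2 * k)) * (Suc (2 * k) choose k)"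
    by (rule Suc_times_binomial)
  moreover have "Suc (2 * k) choose k = Suc (2 * k) choose Suc k"
    by (subst binomial_symmetric) auto
  moreover have "Suc k * (Suc (2 * k) choose Suc k) = Suc (2 * k) * (2 * k choose k)"
    by (rule Suc_times_binomial)
  ultimately have "Suc k * Suc k * (Suc (Suc (2 * k)) choose Suc k) = Suc (Suc (2 * k)) * (Suc (2 * k) * (2 * k choose k))"
    by (metis mult.assoc mult.left_commute)
  moreover have "Suc (Suc (2 * k)) = 2 * Suc k" by simp
  ultimately have "rat_of_nat (Suc k * Suc k * (2 * Suc k choose Suc k)) = of_nat (2 * Suc k * (Suc (2 * k) * (2 * k choose k)))"
    by (simp only:)
  then have "(of_nat k + 1) * ((of_nat k + 1) * rat_of_nat (2 * Suc k choose Suc k)) = (of_nat k + 1) * (2 * (2 * of_nat k + 1) * B)"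
    unfolding of_nat_mult B_def by (simp add: algebra_simps del: binomial_Suc_Suc mult_Suc_right)
  then have "(of_nat k + 1) * rat_of_nat (2 * Suc k choose Suc k) = 2 * (2 * of_nat k + 1) * B"
    using mult_left_cancel[of "rat_of_nat k + 1"] by (metis of_nat_Suc of_nat_neq_0 add.commute)
  then have "rat_of_nat (2 * Suc k choose Suc k) = 2 * (2 * of_nat k + 1) * B / (of_nat k + 1)"
    by (simp add: field_simps del: binomial_Suc_Suc mult_Suc_right)
  then have "(rat_of_nat (2 * Suc k choose Suc k))\<^sup>2 * (1 / 16 ^ Suc k)
     = (2 * (2 * of_nat k + 1) * B / (of_nat k + 1))\<^sup>2 * (1 / 16 ^ Suc k)" by (simp only:)
  also have "\<dots> = B\<^sup>2 * (1 / 16 ^ k) * ((2 * of_nat (Suc k) - 1)\<^sup>2 / (2 * of_nat (Suc k))\<^sup>2)"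
  proof -
    have "(2 * u * B / v)\<^sup>2 * (1 / 16 ^ Suc k) = B\<^sup>2 * (1 / 16 ^ k) * (u\<^sup>2 / (2 * v)\<^sup>2)" for u v :: rat
      by (simp add: power_mult_distrib power_divide)
    moreover have "2 * rat_of_nat (Suc k) - 1 = 2 * of_nat k + 1" "rat_of_nat (Suc k) = of_nat k + 1" by simp_all
    ultimately show ?thesis by (simp only:)
  qed
  also have "\<dots> = (\<Prod>j=1..Suc k. (2 * of_nat j - 1)\<^sup>2 / (2 * of_nat j)\<^sup>2)"
    unfolding B_def Suc.IH by (simp only: prod.nat_ivl_Suc' le_simps) (simp only: mult_ac)
  finally show ?case .
qed simp

text \<open>Since \<open>(2 * j - 1)^2 - (2 * n + 1)^2 = - 4 * (n + 1 - j) * (n + j)\<close>, the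
  product has the denominators of \<open>central_binomial_prod\<close> and numerators shifted by
  \<open>(2 * n + 1)^2\<close>, which will be \<open>p^2\<close>.\<close>

lemma signed_binomial_prod:
  assumes "k \<le> n"
  shows "(-1) ^ k * rat_of_nat (n choose k) * of_nat (n + k choose k)
    = (\<Prod>j=1..k. ((2 * of_nat j - 1)\<^sup>2 - (of_nat (2 * n + 1))\<^sup>2) / (2 * of_nat j)\<^sup>2)"
  using assms
proof (induction k)
  case (Suc k)
  define B C where "B = rat_of_nat (n choose k)" and "C = rat_of_nat (n + k choose k)"
  let ?k = "rat_of_nat (Suc k)"
  have nz: "?k \<noteq> 0" by (simp del: of_nat_Suc)
  have "Suc k * (n choose Suc k) = (n - k) * (n choose k)"
    by (metis binomial_absorb_comp binomial_absorption)
  then have "rat_of_nat (Suc k * (n choose Suc k)) = of_nat ((n - k) * (n choose k))" by (simp only:)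
  moreover have "rat_of_nat (n - k) = of_nat n + 1 - ?k" using Suc.prems by (simp add: of_nat_diff)
  ultimately have "?k * of_nat (n choose Suc k) = (of_nat n + 1 - ?k) * B"
    unfolding of_nat_mult B_def by (simp only:)
  then have b: "of_nat (n choose Suc k) = (of_nat n + 1 - ?k) * B / ?k"
    using nz by (simp add: field_simps del: of_nat_Suc)
  have "Suc k * (Suc (n + k) choose Suc k) = Suc (n + k) * (n + k choose k)"
    by (rule Suc_times_binomial)
  then have "rat_of_nat (Suc k * (n + Suc k choose Suc k)) = of_nat (Suc (n + k) * (n + k choose k))"
    by (simp only: add_Suc_right)
  moreover have "rat_of_nat (Suc (n + k)) = of_nat n + ?k" by simp
  ultimately have "?k * of_nat (n + Suc k choose Suc k) = (of_nat n + ?k) * C"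
    unfolding of_nat_mult C_def by (simp only:)
  then have c: "of_nat (n + Suc k choose Suc k) = (of_nat n + ?k) * C / ?k"
    using nz by (simp add: field_simps del: of_nat_Suc)
  define N where "N = rat_of_nat n"
  have N: "rat_of_nat (2 * n + 1) = 2 * N + 1" by (simp add: N_def)
  have "(-1) ^ Suc k * rat_of_nat (n choose Suc k) * of_nat (n + Suc k choose Suc k)
     = ((-1) ^ k * B * C) * (- (N + 1 - ?k) * (N + ?k) / ?k\<^sup>2)"
  proof -
    have "(-1) ^ Suc k * (u * B / K) * (v * C / K) = ((-1) ^ k * B * C) * (- u * v / K\<^sup>2)" for u v K :: rat
      by (simp add: power2_eq_square mult_ac)
    then show ?thesis unfolding b c N_def .
  qed
  also have "- (N + 1 - ?k) * (N + ?k) / ?k\<^sup>2 = ((2 * ?k - 1)\<^sup>2 - (2 * N + 1)\<^sup>2) / (2 * ?k)\<^sup>2"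
  proof -
    have "(2 * ?k - 1)\<^sup>2 - (2 * N + 1)\<^sup>2 = 4 * (- (N + 1 - ?k) * (N + ?k))"
      by (simp add: power2_eq_square algebra_simps del: of_nat_Suc)
    then show ?thesis by (simp add: power_mult_distrib del: of_nat_Suc)
  qed
  finally show ?case using Suc unfolding B_def C_def N[symmetric]
    by (simp only: prod.nat_ivl_Suc' le_simps Suc_leD) (simp only: mult_ac)
qed simp

text \<open>Corresponding factors of the two products differ by \<open>p^2 / (2 * j)^2\<close>, and
  \<open>2 * j\<close> is prime to \<open>p\<close> because \<open>0 < 2 * j < p\<close>.\<close>

lemma central_binomial_pcong:
  assumes "prime p" "p = 2 * n + 1" "k \<le> n"
  shows "pcong p 2 ((rat_of_nat ((2 * k) choose k))\<^sup>2 * (1 / 16 ^ k))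
    ((-1) ^ k * rat_of_nat (n choose k) * of_nat (n + k choose k))"
  unfolding central_binomial_prod signed_binomial_prod[OF assms(3)]
proof (rule pcong_prod[OF assms(1)])
  fix j assume j: "j \<in> {1..k}"
  let ?x = "2 * rat_of_nat j - 1" and ?d = "(2 * rat_of_nat j)\<^sup>2"
  have "\<not> p dvd 2 * j" using j assms by (auto simp: prime_dvd_mult_iff dest!: dvd_imp_le)
  then have "\<not> p dvd (2 * j)\<^sup>2" using assms(1) prime_dvd_power by blast
  then have div: "x / ?d \<in> zp_ring p" if "x \<in> zp_ring p" for x
    using zp_ring_divide_nat[OF assms(1) that, of "(2 * j)\<^sup>2"] by simp
  show "pcong p 2 (?x\<^sup>2 / ?d) ((?x\<^sup>2 - (of_nat (2 * n + 1))\<^sup>2) / ?d)"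
    unfolding assms(2)[symmetric]
  proof (rule pcongI[OF assms(1)])
    show "(?x\<^sup>2 - (of_nat p)\<^sup>2) / ?d \<in> zp_ring p" by (rule div) (use assms(1) in auto)
    show "1 / ?d \<in> zp_ring p" by (rule div) (use assms(1) in auto)
    show "?x\<^sup>2 / ?d = (?x\<^sup>2 - (of_nat p)\<^sup>2) / ?d + (of_nat p)\<^sup>2 * (1 / ?d)"
      by (simp add: diff_divide_distrib)
  qed
qed

text \<open>The prime divides \<open>fact (2 * k)\<close> but not \<open>fact k\<close>. Squaring
  the coefficient then removes the terms with \<open>k > n\<close> modulo
  \<open>p^2\<close>.\<close>

lemma prime_dvd_central_binomial:
  assumes "prime p" "p \<le> 2 * k" "k < p"
  shows "p dvd (2 * k) choose k"
proof -
  have "p dvd fact k * fact k * ((2 * k) choose k)"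
    using binomial_fact_lemma[of k "2 * k"] assms by (simp add: mult_2 prime_dvd_fact_iff)
  then show ?thesis using assms by (simp add: prime_dvd_mult_iff prime_dvd_fact_iff)
qed

lemma prod_linear_factors:
  fixes c :: rat
  assumes "d \<noteq> 0" "\<And>j. j \<in> A \<Longrightarrow> a j \<noteq> 0" "finite A"
  shows "(\<Prod>j\<in>A. c + d * a j) = d ^ card A * (\<Prod>j\<in>A. a j) * (\<Prod>j\<in>A. 1 + c * (1 / (d * a j)))"
proof -
  have "(\<Prod>j\<in>A. c + d * a j) = (\<Prod>j\<in>A. d * a j * (1 + c * (1 / (d * a j))))"
    using assms by (intro prod.cong) (auto simp: field_simps)
  then show ?thesis by (simp add: prod.distrib)
qed

section \<open>The sum with denominators \<open>d * k + 1\<close>, where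
  \<open>p = d * m + 1\<close>\<close>

context
  fixes p n d m :: nat
  assumes prime: "prime p" and n: "p = 2 * n + 1" and d: "p = d * m + 1" and m: "m \<le> n"
begin

lemma modulus_facts: "0 < m" "0 < d" "\<not> p dvd d" "n < p" "m < p" "0 < n"
proof -
  have p1: "1 < p" using prime prime_gt_1_nat by blast
  show m0: "0 < m" and d0: "0 < d" using p1 d by (auto intro!: Nat.gr0I)
  have "d \<le> d * m" using m0 by simp
  then have "d < p" using d by linarith
  then show "\<not> p dvd d" using d0 by (auto dest: dvd_imp_le)
  show "n < p" "m < p" "0 < n" using n m p1 by auto
qed

text \<open>Modulo \<open>p\<close> the denominator is \<open>d * (k - m)\<close>, with
  \<open>d\<close> prime to \<open>p\<close> and \<open>k - m\<close> nonzero and smaller than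
  \<open>p\<close> in absolute value.\<close>

lemma denominator_unit:
  assumes "k < p" "k \<noteq> m"
  shows "\<not> p dvd d * k + 1"
proof
  assume "p dvd d * k + 1"
  then have "int p dvd int (d * k + 1) - int p" by (simp only: int_dvd_int_iff dvd_diff dvd_refl)
  also have "int (d * k + 1) - int p = int d * (int k - int m)" by (simp add: d algebra_simps)
  finally have "int p dvd int k - int m"
    using prime modulus_facts(3) by (simp add: prime_dvd_mult_iff)
  then have "\<bar>int p\<bar> \<le> \<bar>int k - int m\<bar>" using assms by (intro dvd_imp_le_int) auto
  then show False using assms modulus_facts by auto
qed

lemma quotient_in_zp_ring:
  assumes "k < p" shows "rat_of_nat p / of_nat (d * k + 1) \<in> zp_ring p"
proof (cases "k = m")
  case True
  then have "d * k + 1 = p" using d by simp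
  then show ?thesis using prime prime_gt_0_nat[OF prime] by simp
next
  case False
  show ?thesis
    by (rule zp_ring_divide_nat[OF prime of_nat_in_zp_ring[OF prime] denominator_unit[OF assms False]])
qed

definition reduced_sum :: rat where
  "reduced_sum = (\<Sum>k\<le>n. (-1) ^ k * rat_of_nat (n choose k) * of_nat (n + k choose k) * (of_nat p / of_nat (d * k + 1)))"

lemma sum_pcong_reduced_sum:
  "pcong p 2 (\<Sum>k=0..p - 1. (of_nat ((2 * k) choose k))\<^sup>2 * (1 / 16 ^ k) * (of_nat p / of_nat (d * k + 1))) reduced_sum"
proof -
  let ?f = "\<lambda>k. (rat_of_nat ((2 * k) choose k))\<^sup>2 * (1 / 16 ^ k) * (of_nat p / of_nat (d * k + 1))"
  have ndvd16: "\<not> p dvd 16 ^ k" for k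
  proof
    assume "p dvd 16 ^ k"
    then have "p dvd 2 ^ (4 * k)" by (simp add: power_mult)
    then have "p dvd 2" using prime prime_dvd_power by blast
    then have "p \<le> 2" by (simp add: dvd_imp_le)
    then show False using n modulus_facts by simp
  qed
  have "pcong p 2 (\<Sum>k\<in>{0..p - 1}. ?f k) (\<Sum>k\<in>{0..p - 1}. if k \<le> n
     then (-1) ^ k * rat_of_nat (n choose k) * of_nat (n + k choose k) * (of_nat p / of_nat (d * k + 1)) else 0)"
  proof (rule pcong_sum[OF prime])
    fix k assume "k \<in> {0..p - 1}"
    then have k: "k < p" using modulus_facts by auto
    show "pcong p 2 (?f k) (if k \<le> n
       then (-1) ^ k * rat_of_nat (n choose k) * of_nat (n + k choose k) * (of_nat p / of_nat (d * k + 1)) else 0)"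
    proof (cases "k \<le> n")
      case True
      have "pcong p 2 (?f k) ((-1) ^ k * rat_of_nat (n choose k) * of_nat (n + k choose k) * (of_nat p / of_nat (d * k + 1)))"
        using central_binomial_pcong[OF prime n True] pcong_refl[OF prime quotient_in_zp_ring[OF k]]
        by (rule pcong_mult[OF prime])
      then show ?thesis using True by simp
    next
      case False
      then have "p dvd (2 * k) choose k" using k n prime_dvd_central_binomial[OF prime] by simp
      then obtain c where c: "(2 * k) choose k = p * c" by auto
      have "?f k = of_nat p ^ 2 * (of_nat c ^ 2 * (1 / of_nat (16 ^ k)) * (of_nat p / of_nat (d * k + 1)))"
        by (simp add: c power_mult_distrib)
      moreover have "of_nat c ^ 2 * (1 / of_nat (16 ^ k)) * (of_nat p / of_nat (d * k + 1)) \<in> zp_ring p"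
        by (rule zp_ring_mult[OF prime zp_ring_mult[OF prime _ zp_ring_divide_nat[OF prime _ ndvd16]] quotient_in_zp_ring[OF k]])
          (use prime in auto)
      ultimately show ?thesis using False pcong_p_zero[OF prime] by (simp only: if_False)
    qed
  qed
  also have "(\<Sum>k\<in>{0..p - 1}. if k \<le> n
     then (-1) ^ k * rat_of_nat (n choose k) * of_nat (n + k choose k) * (of_nat p / of_nat (d * k + 1)) else 0)
     = reduced_sum"
    unfolding reduced_sum_def
    by (rule sum.mono_neutral_cong_right) (use modulus_facts in auto)
  finally show ?thesis .
qed

text \<open>Partial fractions at \<open>z = 1 / d\<close>. The factor for \<open>j = m\<close> is
  exactly \<open>p\<close> and cancels the \<open>p\<close> in the numerators of the sum, so it is
  left out of the product.\<close>

lemma reduced_sum_prod: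
  "reduced_sum * (\<Prod>j\<in>{..n} - {m}. rat_of_nat (d * j + 1)) = (\<Prod>j=1..n. of_nat d * of_nat j - 1)"
proof -
  define c where "c k = (-1) ^ k * rat_of_nat (n choose k) * of_nat (n + k choose k)" for k
  define z where "z = 1 / rat_of_nat d"
  define F where "F = (\<Sum>k\<le>n. c k / (of_nat k + z))"
  define D where "D = rat_of_nat d"
  have D: "D \<noteq> 0" using modulus_facts by (simp add: D_def)
  have P0: "rat_of_nat p \<noteq> 0" using modulus_facts by auto
  have z: "of_nat j + z = of_nat (d * j + 1) / D" for j
    using D by (simp add: z_def D_def field_simps)
  have z': "of_nat j - z = (D * of_nat j - 1) / D" for j
    using D by (simp add: z_def D_def field_simps)
  have "F * (\<Prod>j\<le>n. of_nat j + z) = (\<Prod>j=1..n. of_nat j - z)"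
    unfolding F_def c_def
  proof (rule partial_fraction_binomial)
    fix j show "of_nat j + z \<noteq> 0"
      unfolding z using D by (simp add: add_nonneg_eq_0_iff)
  qed
  then have "F * ((\<Prod>j\<le>n. of_nat (d * j + 1)) / D ^ Suc n) = (\<Prod>j=1..n. D * of_nat j - 1) / D ^ n"
    unfolding z z' prod_dividef by simp
  then have FN: "F * (\<Prod>j\<le>n. rat_of_nat (d * j + 1)) = D * (\<Prod>j=1..n. D * of_nat j - 1)"
    using D by (simp add: field_simps)
  have "(\<Prod>j\<le>n. rat_of_nat (d * j + 1)) = of_nat p * (\<Prod>j\<in>{..n} - {m}. rat_of_nat (d * j + 1))"
    using m d by (subst prod.remove[of _ m]) auto
  then have FN': "of_nat p * (F * (\<Prod>j\<in>{..n} - {m}. rat_of_nat (d * j + 1))) = D * (\<Prod>j=1..n. D * of_nat j - 1)"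
    using FN by (simp only: mult_ac)
  have "D * reduced_sum = of_nat p * F"
    unfolding reduced_sum_def F_def sum_distrib_left c_def[symmetric] z
    using D by (intro sum.cong refl) (simp add: field_simps)
  then have "D * (reduced_sum * (\<Prod>j\<in>{..n} - {m}. rat_of_nat (d * j + 1))) = D * (\<Prod>j=1..n. D * of_nat j - 1)"
    unfolding FN'[symmetric] by (simp only: mult.assoc[symmetric])
  then show ?thesis using D by (simp add: D_def)
qed

text \<open>From \<open>p = d * m + 1\<close> one has \<open>d * j + 1 = p + d * (j - m)\<close> and
  \<open>d * j - 1 = - p + d * (j + m)\<close>. Extracting the multiples of \<open>d\<close> leaves
  factors near 1. The factorials combine to \<open>(n choose m)^2\<close> times a quotient of two
  coefficients of row \<open>p - 1\<close>, which \<open>binomial_pred_prime\<close>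
  expands.\<close>

lemma reduced_sum_eq:
  "reduced_sum * ((\<Prod>i=1..m. 1 + of_nat p * (1 / (- of_nat d * of_nat i)))
      * (\<Prod>i=1..n - m. 1 + of_nat p * (1 / (of_nat d * of_nat i)))
      * ((-1) ^ (n - m) * of_nat (p - 1 choose (n - m))))
   = (of_nat (n choose m))\<^sup>2 * ((\<Prod>j=1..n. 1 + of_nat p * (- 1 / (of_nat d * of_nat (j + m))))
      * ((-1) ^ n * of_nat (p - 1 choose n)))"
  (is "_ * (?X1 * ?X2 * _) = _ * (?Y1 * _)")
proof -
  define D where "D = rat_of_nat d"
  have D: "D \<noteq> 0" using modulus_facts by (simp add: D_def)
  have pD: "rat_of_nat p = D * of_nat m + 1" by (subst d) (simp add: D_def)
  have "(\<Prod>j\<in>{..n} - {m}. rat_of_nat (d * j + 1))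
     = (\<Prod>j<m. rat_of_nat (d * j + 1)) * (\<Prod>j\<in>{m<..n}. rat_of_nat (d * j + 1))"
    using m by (subst prod.union_disjoint[symmetric]) (auto intro!: prod.cong)
  also have "(\<Prod>j<m. rat_of_nat (d * j + 1)) = (\<Prod>i=1..m. of_nat p + (- D) * of_nat i)"
    unfolding pD by (rule prod.reindex_bij_witness[of _ "\<lambda>i. m - i" "\<lambda>j. m - j"])
      (auto simp: D_def of_nat_diff algebra_simps)
  also have "\<dots> = (- D) ^ m * fact m * ?X1"
    by (subst prod_linear_factors) (use D in \<open>auto simp: fact_prod D_def\<close>)
  also have "(\<Prod>j\<in>{m<..n}. rat_of_nat (d * j + 1)) = (\<Prod>i=1..n - m. of_nat p + D * of_nat i)"
    unfolding pD by (rule prod.reindex_bij_witness[of _ "\<lambda>i. i + m" "\<lambda>j. j - m"])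
      (auto simp: D_def of_nat_diff algebra_simps)
  also have "\<dots> = D ^ (n - m) * fact (n - m) * ?X2"
    by (subst prod_linear_factors) (use D in \<open>auto simp: fact_prod D_def\<close>)
  finally have den: "(\<Prod>j\<in>{..n} - {m}. rat_of_nat (d * j + 1))
     = ((- D) ^ m * fact m * ?X1) * (D ^ (n - m) * fact (n - m) * ?X2)" .
  have "(\<Prod>j=1..n. of_nat d * of_nat j - 1) = (\<Prod>j=1..n. - of_nat p + D * of_nat (j + m))"
    unfolding pD by (intro prod.cong) (auto simp: D_def algebra_simps)
  also have "\<dots> = D ^ n * (\<Prod>j=1..n. of_nat (j + m)) * ?Y1"
    by (subst prod_linear_factors) (use D modulus_facts in \<open>auto simp: D_def\<close>)
  finally have num: "(\<Prod>j=1..n. of_nat d * of_nat j - 1) = D ^ n * (\<Prod>j=1..n. rat_of_nat (j + m)) * ?Y1" .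
  have fnm: "fact m * (\<Prod>j=1..n. rat_of_nat (j + m)) = fact (n + m)"
  proof (induction n)
    case (Suc n)
    have "fact m * (\<Prod>j=1..Suc n. rat_of_nat (j + m)) = fact m * (\<Prod>j=1..n. rat_of_nat (j + m)) * of_nat (Suc n + m)"
      by (simp del: of_nat_add of_nat_Suc)
    then show ?case unfolding Suc by (simp add: mult.commute)
  qed simp
  have pn: "p - 1 - n = n" "p - 1 - (n - m) = n + m" "n \<le> p - 1" "n - m \<le> p - 1" using n m by auto
  have "fact (n - m) * fact (n + m) * (p - 1 choose (n - m)) = fact n * fact n * (p - 1 choose n)"
    using binomial_fact_lemma[OF pn(3)] binomial_fact_lemma[OF pn(4)] unfolding pn by simp
  then have f1: "fact (n - m) * fact (n + m) * rat_of_nat (p - 1 choose (n - m)) = fact n * fact n * of_nat (p - 1 choose n)"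
    by (metis of_nat_fact of_nat_mult)
  have f2: "fact m * fact (n - m) * rat_of_nat (n choose m) = fact n"
    using binomial_fact_lemma[OF m] by (metis of_nat_fact of_nat_mult)
  define K where "K = D ^ n * (fact m * fact (n - m))\<^sup>2"
  have K: "K \<noteq> 0" using D by (simp add: K_def)
  have Dn: "(- D) ^ m * D ^ (n - m) = (-1) ^ m * D ^ n"
    using m by (simp add: power_minus[of D] flip: power_add)
  have sgn: "(-1::rat) ^ m * (-1) ^ (n - m) = (-1) ^ n" using m by (simp flip: power_add)
  let ?B = "rat_of_nat (p - 1 choose (n - m))"
  have "reduced_sum * ((-1) ^ m * D ^ n * fact m * fact (n - m) * ?X1 * ?X2) = D ^ n * (\<Prod>j=1..n. rat_of_nat (j + m)) * ?Y1"
    using reduced_sum_prod unfolding den num Dn[symmetric] by (simp only: mult_ac)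
  then have "(reduced_sum * ((-1) ^ m * D ^ n * fact m * fact (n - m) * ?X1 * ?X2)) * (fact m * fact (n - m) * ?B)
    = (D ^ n * (\<Prod>j=1..n. rat_of_nat (j + m)) * ?Y1) * (fact m * fact (n - m) * ?B)" by (simp only:)
  also have "\<dots> = D ^ n * ?Y1 * (fact (n - m) * (fact m * (\<Prod>j=1..n. rat_of_nat (j + m))) * ?B)"
    by (simp only: mult_ac)
  also have "\<dots> = D ^ n * ?Y1 * ((fact m * fact (n - m) * of_nat (n choose m)) * (fact m * fact (n - m) * of_nat (n choose m)) * of_nat (p - 1 choose n))"
    unfolding fnm f1 f2 ..
  also have "\<dots> = K * (of_nat (n choose m))\<^sup>2 * (?Y1 * of_nat (p - 1 choose n))"
    unfolding K_def power2_eq_square by (simp only: mult_ac)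
  also have "(reduced_sum * ((-1) ^ m * D ^ n * fact m * fact (n - m) * ?X1 * ?X2)) * (fact m * fact (n - m) * ?B)
    = K * (reduced_sum * ((-1) ^ m * (?X1 * ?X2 * ?B)))"
    unfolding K_def power2_eq_square by (simp only: mult_ac)
  finally have "K * (reduced_sum * ((-1) ^ m * (?X1 * ?X2 * ?B))) = K * ((of_nat (n choose m))\<^sup>2 * (?Y1 * of_nat (p - 1 choose n)))"
    by (simp only: mult.assoc)
  then have eq: "reduced_sum * ((-1) ^ m * (?X1 * ?X2 * ?B)) = (of_nat (n choose m))\<^sup>2 * (?Y1 * of_nat (p - 1 choose n))"
    using K mult_left_cancel by blast
  have "(-1) ^ n * (reduced_sum * ((-1) ^ m * (?X1 * ?X2 * ?B)))
      = (-1) ^ n * ((of_nat (n choose m))\<^sup>2 * (?Y1 * of_nat (p - 1 choose n)))" by (simp only: eq)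
  moreover have "(-1) ^ n * (reduced_sum * ((-1) ^ m * (?X1 * ?X2 * ?B)))
     = ((-1) ^ m * (-1) ^ m) * (reduced_sum * (?X1 * ?X2 * ((-1) ^ (n - m) * ?B)))"
    unfolding sgn[symmetric] by (simp only: mult_ac)
  moreover have "(-1::rat) ^ m * (-1) ^ m = 1" by (simp flip: power_add mult_2)
  ultimately show ?thesis by (simp only: mult_1 mult_ac)
qed

text \<open>Every product in \<open>reduced_sum_eq\<close> is linearised and the equation is solved
  for \<open>reduced_sum\<close>.\<close>

theorem sum_central_binomial_pcong:
  "pcong p 2 (\<Sum>k=0..p - 1. (of_nat ((2 * k) choose k))\<^sup>2 * (1 / 16 ^ k) * (of_nat p / of_nat (d * k + 1)))
    ((of_nat (n choose m))\<^sup>2 *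
      (1 + of_nat p * (hsum (n - m) - hsum n + 2 / of_nat d * (hsum m - hsum (n - m)))))"
proof -
  let ?C = "(rat_of_nat (n choose m))\<^sup>2"
  let ?D = "rat_of_nat d"
  have div: "x / (?D * of_nat j) \<in> zp_ring p" if "x \<in> zp_ring p" "0 < j" "j < p" for x j
  proof -
    have "\<not> p dvd d * j" using that modulus_facts prime by (auto simp: prime_dvd_mult_iff dest!: dvd_imp_le)
    then show ?thesis using zp_ring_divide_nat[OF prime that(1), of "d * j"] by simp
  qed
  have divd: "x / ?D \<in> zp_ring p" if "x \<in> zp_ring p" for x
    using zp_ring_divide_nat[OF prime that modulus_facts(3)] .
  have nm: "n - m < p" "n + m < p" using n m modulus_facts by auto
  note hring = hsum_in_zp_ring[OF prime nm(1)] hsum_in_zp_ring[OF prime nm(2)]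
    hsum_in_zp_ring[OF prime modulus_facts(4)] hsum_in_zp_ring[OF prime modulus_facts(5)]
  have sumd: "(\<Sum>i=1..k. 1 / (?D * of_nat i)) = hsum k / ?D" for k
    by (simp add: hsum_def sum_divide_distrib mult.commute)
  have "pcong p 2 (\<Prod>i=1..m. 1 + of_nat p * (1 / (- ?D * of_nat i))) (1 + of_nat p * (\<Sum>i=1..m. 1 / (- ?D * of_nat i)))"
  proof (rule pcong_prod_one_plus[OF prime])
    fix i assume "i \<in> {1..m}"
    then have "(- 1) / (?D * of_nat i) \<in> zp_ring p" using modulus_facts prime by (intro div) auto
    then show "1 / (- ?D * of_nat i) \<in> zp_ring p" by simp
  qed simp
  moreover have "(\<Sum>i=1..m. 1 / (- ?D * of_nat i)) = - hsum m / ?D"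
    using sumd[of m] by (simp add: sum_negf)
  ultimately have X1: "pcong p 2 (\<Prod>i=1..m. 1 + of_nat p * (1 / (- ?D * of_nat i))) (1 + of_nat p * (- hsum m / ?D))"
    by (simp only:)
  have "pcong p 2 (\<Prod>i=1..n - m. 1 + of_nat p * (1 / (?D * of_nat i))) (1 + of_nat p * (\<Sum>i=1..n - m. 1 / (?D * of_nat i)))"
    using nm prime by (intro pcong_prod_one_plus) (auto intro!: div)
  then have X2: "pcong p 2 (\<Prod>i=1..n - m. 1 + of_nat p * (1 / (?D * of_nat i))) (1 + of_nat p * (hsum (n - m) / ?D))"
    unfolding sumd .
  have "pcong p 2 (\<Prod>j=1..n. 1 + of_nat p * (- 1 / (?D * of_nat (j + m)))) (1 + of_nat p * (\<Sum>j=1..n. - 1 / (?D * of_nat (j + m))))"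
    using nm prime by (intro pcong_prod_one_plus div) auto
  moreover have "(\<Sum>j=1..n. - 1 / (?D * of_nat (j + m))) = - (hsum (n + m) - hsum m) / ?D"
  proof -
    have "hsum (n + m) - hsum m = (\<Sum>j=1..n. 1 / of_nat (j + m))"
      by (induction n) (simp_all add: hsum_Suc algebra_simps)
    then show ?thesis by (simp add: sum_divide_distrib sum_negf mult.commute)
  qed
  ultimately have Y1: "pcong p 2 (\<Prod>j=1..n. 1 + of_nat p * (- 1 / (?D * of_nat (j + m)))) (1 + of_nat p * (- (hsum (n + m) - hsum m) / ?D))"
    by (simp only:)
  have X: "pcong p 2 ((\<Prod>i=1..m. 1 + of_nat p * (1 / (- of_nat d * of_nat i)))
      * (\<Prod>i=1..n - m. 1 + of_nat p * (1 / (of_nat d * of_nat i)))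
      * ((-1) ^ (n - m) * of_nat (p - 1 choose (n - m))))
     (1 + of_nat p * ((- hsum m / ?D + hsum (n - m) / ?D) + - hsum (n - m)))"
    using hring prime
    by (intro pcong_one_plus_mult X1 X2 binomial_pred_prime nm divd zp_ring_add zp_ring_uminus)
  have Y: "pcong p 2 ((\<Prod>j=1..n. 1 + of_nat p * (- 1 / (of_nat d * of_nat (j + m))))
      * ((-1) ^ n * of_nat (p - 1 choose n)))
     (1 + of_nat p * (- (hsum (n + m) - hsum m) / ?D + - hsum n))"
    using hring prime
    by (intro pcong_one_plus_mult Y1 binomial_pred_prime modulus_facts divd zp_ring_diff zp_ring_uminus)
  have "pcong p 2 reduced_sum (?C * (1 + of_nat p * ((- (hsum (n + m) - hsum m) / ?D + - hsum n)
      - ((- hsum m / ?D + hsum (n - m) / ?D) + - hsum (n - m)))))"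
    by (rule pcong_solve_one_plus[OF prime _ _ _ _ reduced_sum_eq X Y])
      (use hring prime pcong_ring(2)[OF sum_pcong_reduced_sum] in
        \<open>auto intro!: zp_ring_add zp_ring_uminus zp_ring_diff divd zp_ring_power simp del: minus_diff_eq\<close>)
  \<comment> \<open>The coefficient of \<open>p\<close> matters only modulo \<open>p\<close>. As
    \<open>n + m\<close> and \<open>n - m\<close> add up to \<open>p - 1\<close>, reflection
    replaces \<open>hsum (n + m)\<close> by \<open>hsum (n - m)\<close>.\<close>
  moreover have "pcong p 2 (?C * (1 + of_nat p * ((- (hsum (n + m) - hsum m) / ?D + - hsum n)
      - ((- hsum m / ?D + hsum (n - m) / ?D) + - hsum (n - m)))))
     (?C * (1 + of_nat p * (hsum (n - m) - hsum n + 2 / ?D * (hsum m - hsum (n - m)))))"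
  proof (rule pcong_mult[OF prime pcong_refl[OF prime] pcong_add[OF prime pcong_refl[OF prime]]])
    have r: "p - 1 - (n - m) = n + m" using n m by simp
    have "odd p" using n by simp
    have "pcong p 1 (hsum (n + m)) (hsum (n - m))"
      using hsum_reflect[OF prime \<open>odd p\<close> nm(1)] unfolding r .
    then have h: "pcong p 1 (1 / ?D * hsum (n + m)) (1 / ?D * hsum (n - m))"
      using prime by (intro pcong_mult pcong_refl divd) auto
    define W where "W = hsum (n - m) - hsum n + 2 / ?D * hsum m - 1 / ?D * hsum (n - m)"
    have W: "W \<in> zp_ring p" unfolding W_def
      using hring prime by (auto intro!: zp_ring_add zp_ring_diff zp_ring_mult divd)
    have "pcong p 1 (W - 1 / ?D * hsum (n + m)) (W - 1 / ?D * hsum (n - m))"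
      by (rule pcong_diff[OF prime pcong_refl[OF prime W] h])
    moreover have "W - 1 / ?D * hsum (n + m) = (- (hsum (n + m) - hsum m) / ?D + - hsum n)
      - ((- hsum m / ?D + hsum (n - m) / ?D) + - hsum (n - m))"
      by (simp add: W_def diff_divide_distrib algebra_simps)
    moreover have "W - 1 / ?D * hsum (n - m) = hsum (n - m) - hsum n + 2 / ?D * (hsum m - hsum (n - m))"
      by (simp add: W_def algebra_simps)
    ultimately have "pcong p 1 ((- (hsum (n + m) - hsum m) / ?D + - hsum n)
      - ((- hsum m / ?D + hsum (n - m) / ?D) + - hsum (n - m)))
      (hsum (n - m) - hsum n + 2 / ?D * (hsum m - hsum (n - m)))" by simp
    from pcong_mult_p[OF prime this]
    show "pcong p 2 (of_nat p * ((- (hsum (n + m) - hsum m) / ?D + - hsum n)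
      - ((- hsum m / ?D + hsum (n - m) / ?D) + - hsum (n - m))))
      (of_nat p * (hsum (n - m) - hsum n + 2 / ?D * (hsum m - hsum (n - m))))"
      by (simp only: Suc_1)
  qed (use prime in auto)
  ultimately show ?thesis
    using pcong_trans[OF sum_pcong_reduced_sum pcong_trans] prime by blast
qed

end

section \<open>Power sums of Teichmueller representatives\<close>

text \<open>In the factorisation of \<open>x ^ p - y ^ p\<close> the cofactor of
  \<open>x - y\<close> is a sum of \<open>p\<close> terms that agree modulo \<open>p\<close>, so
  each \<open>p\<close>-th power gains a factor \<open>p\<close>. Hence \<open>a ^ (p ^ e)\<close>
  depends on the residue of \<open>a\<close> modulo \<open>p\<close> only.\<close>

lemma cong_power_prime_power:
  fixes a b :: int
  assumes "[a = b] (mod int p)"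
  shows "[a ^ (p ^ e) = b ^ (p ^ e)] (mod int p ^ Suc e)"
proof (induction e)
  case (Suc e)
  define x y where "x = a ^ (p ^ e)" and "y = b ^ (p ^ e)"
  have dvd1: "int p ^ Suc e dvd x - y" using Suc by (simp add: x_def y_def cong_iff_dvd_diff)
  have "int p dvd x - y" using dvd1 unfolding power_Suc by (rule dvd_mult_left)
  then have xy: "[x = y] (mod int p)" by (simp add: cong_iff_dvd_diff)
  show ?case
  proof (cases p)
    case (Suc m)
    have "x ^ p - y ^ p = (x - y) * (\<Sum>i<p. x ^ i * y ^ (m - i))"
      unfolding Suc by (rule diff_power_eq_sum)
    moreover have "[(\<Sum>i<p. x ^ i * y ^ (m - i)) = (\<Sum>i<p. y ^ i * y ^ (m - i))] (mod int p)"
      by (intro cong_sum cong_mult cong_pow xy cong_refl)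
    moreover have "(\<Sum>i<p. y ^ i * y ^ (m - i)) = (\<Sum>i<p. y ^ m)"
      by (intro sum.cong) (auto simp: Suc simp flip: power_add)
    moreover have "int p dvd (\<Sum>i<p. y ^ m)" by simp
    ultimately have "int p dvd (\<Sum>i<p. x ^ i * y ^ (m - i))"
      using cong_dvd_iff by metis
    then have "int p ^ Suc e * int p dvd x ^ p - y ^ p"
      unfolding \<open>x ^ p - y ^ p = _\<close> by (rule mult_dvd_mono[OF dvd1])
    moreover have "a ^ p ^ Suc e = x ^ p" "b ^ p ^ Suc e = y ^ p"
      unfolding x_def y_def power_mult[symmetric] by (simp_all add: mult.commute)
    ultimately show ?thesis
      by (simp only: cong_iff_dvd_diff power_Suc2)
  qed simp
qed (use assms in simp)


text \<open>An injective map of the residues permutes them; \<open>h\<close> may leave the range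
  since \<open>f\<close> depends on residues only.\<close>

lemma sum_residues_reindex:
  fixes f :: "int \<Rightarrow> int" and h :: "int \<Rightarrow> int"
  assumes "0 < p"
    and "\<And>a b. [a = b] (mod p) \<Longrightarrow> [f a = f b] (mod M)"
    and "\<And>a b. a \<in> {0..<p} \<Longrightarrow> b \<in> {0..<p} \<Longrightarrow> [h a = h b] (mod p) \<Longrightarrow> a = b"
  shows "[(\<Sum>a\<in>{0..<p}. f (h a)) = (\<Sum>a\<in>{0..<p}. f a)] (mod M)"
proof -
  let ?g = "\<lambda>a. h a mod p"
  have inj: "inj_on ?g {0..<p}"
  proof (rule inj_onI)
    fix a b assume "a \<in> {0..<p}" "b \<in> {0..<p}" "?g a = ?g b"
    then show "a = b" by (intro assms(3)) (simp_all only: cong_def)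
  qed
  have "?g ` {0..<p} \<subseteq> {0..<p}" using assms(1) by auto
  then have img: "?g ` {0..<p} = {0..<p}"
    using inj by (intro endo_inj_surj) simp_all
  have "[(\<Sum>a\<in>{0..<p}. f (h a)) = (\<Sum>a\<in>{0..<p}. f (?g a))] (mod M)"
    by (intro cong_sum assms(2)) (simp add: cong_def)
  also have "(\<Sum>a\<in>{0..<p}. f (?g a)) = (\<Sum>a\<in>{0..<p}. f a)"
    using sum.reindex[OF inj, of f] img by (simp add: o_def)
  finally show ?thesis .
qed

lemma cong_mult_cancel_prime_power:
  fixes u x y :: int
  assumes "prime p" "\<not> int p dvd u" "[u * x = u * y] (mod int p ^ e)"
  shows "[x = y] (mod int p ^ e)"
proof -
  have "coprime u (int p ^ e)"
    using assms(1,2) prime_imp_coprime[of "int p" u]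
    by (simp add: coprime_commute)
  then show ?thesis using assms(3) by (simp add: cong_mult_lcancel)
qed

lemma fermat_int:
  fixes a :: int
  assumes "prime p" "\<not> int p dvd a"
  shows "[a ^ (p - 1) = 1] (mod int p)"
proof -
  have "[nat (a mod int p) ^ (p - 1) = 1] (mod p)"
  proof (rule fermat_theorem[OF assms(1)])
    have "int (nat (a mod int p)) = a mod int p" using assms(1) prime_gt_0_nat[of p] by simp
    moreover have "\<not> int p dvd a mod int p" using assms(2) by (simp add: dvd_mod_iff)
    ultimately show "\<not> p dvd nat (a mod int p)"
      by (metis int_dvd_int_iff)
  qed
  then have "[int (nat (a mod int p)) ^ (p - 1) = 1] (mod int p)"
    unfolding cong_int_iff[symmetric] by simp
  then have "[(a mod int p) ^ (p - 1) = 1] (mod int p)" using assms(1) prime_gt_0_nat[of p] by simp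
  then show ?thesis unfolding cong_def power_mod .
qed

text \<open>If \<open>p - 1\<close> divides \<open>k\<close>, every nonzero residue contributes 1.
  Otherwise multiplication by a primitive root permutes the residues and scales the sum by a factor
  that is not 1 modulo \<open>p\<close>, so the sum vanishes.\<close>

lemma power_sum_teichmuller:
  assumes "prime p" "0 < k"
  shows "[(\<Sum>a\<in>{0..<int p}. a ^ (p ^ e * k)) = (if p - 1 dvd k then int p - 1 else 0)] (mod int p ^ Suc e)"
proof (cases "p - 1 dvd k")
  case True
  then obtain l where l: "k = (p - 1) * l" by auto
  have "[a ^ (p ^ e * k) = (if a = 0 then 0 else 1)] (mod int p ^ Suc e)"
    if a: "a \<in> {0..<int p}" for a
  proof (cases "a = 0")
    case False
    then have "\<not> int p dvd a" using a zdvd_not_zless by auto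
    then have "[a ^ (p - 1) = 1] (mod int p)" using fermat_int assms by blast
    then have "[(a ^ (p - 1)) ^ l = 1 ^ l] (mod int p)" by (rule cong_pow)
    then have "[(a ^ k) ^ (p ^ e) = 1 ^ (p ^ e)] (mod int p ^ Suc e)"
      by (intro cong_power_prime_power) (simp add: l power_mult)
    then show ?thesis using False by (simp add: power_mult[symmetric] mult.commute)
  qed (use assms prime_gt_0_nat[of p] in \<open>simp add: power_0_left\<close>)
  then have "[(\<Sum>a\<in>{0..<int p}. a ^ (p ^ e * k)) = (\<Sum>a\<in>{0..<int p}. if a = 0 then 0 else 1)] (mod int p ^ Suc e)"
    by (rule cong_sum)
  also have "(\<Sum>a\<in>{0..<int p}. if a = 0 then 0 else (1::int)) = (\<Sum>a\<in>{0..<int p} - {0}. 1)"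
    by (rule sum.mono_neutral_cong_right) auto
  also have "\<dots> = int p - 1" using assms prime_gt_1_nat[of p] by simp
  finally show ?thesis using True by simp
next
  case False
  obtain g where g: "residue_primroot p g" using prime_primitive_root_exists assms(1) prime_gt_1_nat by blast
  then have "ord p g = p - 1" "coprime p g" using assms(1) by (auto simp: residue_primroot_def totient_prime)
  then have gk: "\<not> [g ^ k = 1] (mod p)" using False ord_divides[of g k p] by metis
  have ndvd: "\<not> int p dvd int g" using \<open>coprime p g\<close> assms(1)
    coprime_common_divisor_nat[of p g p] prime_gt_1_nat[of p] by auto
  let ?S = "\<Sum>a\<in>{0..<int p}. a ^ (p ^ e * k)"
  have "[(\<Sum>a\<in>{0..<int p}. (int g * a) ^ (p ^ e * k)) = ?S] (mod int p ^ Suc e)"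
  proof (rule sum_residues_reindex)
    fix a b :: int assume "[a = b] (mod int p)"
    then show "[a ^ (p ^ e * k) = b ^ (p ^ e * k)] (mod int p ^ Suc e)"
      unfolding power_mult by (intro cong_pow cong_power_prime_power)
  next
    fix a b assume ab: "a \<in> {0..<int p}" "b \<in> {0..<int p}" "[int g * a = int g * b] (mod int p)"
    have "[a = b] (mod int p ^ 1)"
      by (rule cong_mult_cancel_prime_power[OF assms(1) ndvd]) (use ab in simp)
    then show "a = b" using ab by (simp add: cong_def)
  qed (use assms prime_gt_0_nat in auto)
  moreover have "(\<Sum>a\<in>{0..<int p}. (int g * a) ^ (p ^ e * k)) = int g ^ (p ^ e * k) * ?S"
    by (simp only: power_mult_distrib sum_distrib_left)
  ultimately have "[(int g ^ (p ^ e * k) - 1) * ?S = (int g ^ (p ^ e * k) - 1) * 0] (mod int p ^ Suc e)"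
    by (simp only: cong_iff_dvd_diff left_diff_distrib mult_1 mult_zero_right diff_zero)
  moreover have "\<not> int p dvd int g ^ (p ^ e * k) - 1"
  proof
    have "[int g ^ (p ^ e) = int g] (mod int p)"
    proof (induction e)
      case (Suc e)
      have "[(int g ^ (p ^ e)) ^ p = int g ^ p] (mod int p)" using Suc by (rule cong_pow)
      also have "int g ^ p = int g ^ (p - 1) * int g"
        using assms(1) prime_gt_0_nat by (simp flip: power_Suc2)
      also have "[int g ^ (p - 1) * int g = 1 * int g] (mod int p)"
        using fermat_int[OF assms(1) ndvd] by (intro cong_mult) auto
      finally show ?case by (simp add: power_mult[symmetric] mult.commute)
    qed simp
    then have "[(int g ^ (p ^ e)) ^ k = int g ^ k] (mod int p)" by (rule cong_pow)
    moreover assume "int p dvd int g ^ (p ^ e * k) - 1"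
    ultimately have "[int g ^ k = 1] (mod int p)"
      unfolding power_mult cong_iff_dvd_diff[symmetric] using cong_sym cong_trans by blast
    then have "[int (g ^ k) = int 1] (mod int p)" by simp
    then show False using gk unfolding cong_int_iff by simp
  qed
  ultimately have "[?S = 0] (mod int p ^ Suc e)" using cong_mult_cancel_prime_power assms(1) by blast
  then show ?thesis using False by simp
qed

section \<open>Legendre symbols\<close>

lemma Legendre_cong: "[a = b] (mod m) \<Longrightarrow> Legendre a m = Legendre b m"
  by (simp add: Legendre_def QuadRes_def cong_def)

lemma Legendre_abs_le: "\<bar>Legendre a m\<bar> \<le> 1"
  by (simp add: Legendre_def)

lemma Legendre_eq_0_iff: "Legendre a m = 0 \<longleftrightarrow> m dvd a"
  by (simp add: Legendre_def cong_0_iff)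

lemma Legendre_1: "1 < m \<Longrightarrow> Legendre 1 m = 1"
  unfolding Legendre_def QuadRes_def
  by (auto simp: cong_def intro: exI[of _ 1])

text \<open>Lifts a congruence between Legendre values, as Euler's criterion gives it, to an
  equality.\<close>

lemma abs_le_1_cong_eq:
  fixes x y m :: int
  assumes "[x = y] (mod m)" "\<bar>x\<bar> \<le> 1" "\<bar>y\<bar> \<le> 1" "2 < m"
  shows "x = y"
proof (rule ccontr)
  assume "x \<noteq> y"
  moreover have "m dvd x - y" using assms(1) by (simp add: cong_iff_dvd_diff)
  ultimately have "\<bar>m\<bar> \<le> \<bar>x - y\<bar>" by (intro dvd_imp_le_int) auto
  then show False using assms by linarith
qed

lemma Legendre_mult:
  assumes "prime p" "2 < p"
  shows "Legendre (a * b) (int p) = Legendre a (int p) * Legendre b (int p)"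
proof (rule abs_le_1_cong_eq)
  have "[Legendre (a * b) (int p) = (a * b) ^ ((p - 1) div 2)] (mod int p)"
    using euler_criterion assms by blast
  also have "(a * b) ^ ((p - 1) div 2) = a ^ ((p - 1) div 2) * b ^ ((p - 1) div 2)"
    by (rule power_mult_distrib)
  also have "[\<dots> = Legendre a (int p) * Legendre b (int p)] (mod int p)"
    using cong_sym[OF euler_criterion[OF assms]] by (intro cong_mult)
  finally show "[Legendre (a * b) (int p) = Legendre a (int p) * Legendre b (int p)] (mod int p)" .
  show "\<bar>Legendre a (int p) * Legendre b (int p)\<bar> \<le> 1"
    unfolding abs_mult using mult_mono[OF Legendre_abs_le Legendre_abs_le, of b "int p" a "int p"] by (simp add: mult.commute)
qed (use assms Legendre_abs_le in auto)

lemma Legendre_mult_self: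
  assumes "prime p" "2 < p" "\<not> int p dvd a"
  shows "Legendre a (int p) * Legendre a (int p) = 1"
  using assms by (auto simp: Legendre_def cong_0_iff)

text \<open>Euler's criterion raised to the power \<open>p ^ e\<close>; this power is odd and fixes
  the values -1, 0 and 1.\<close>

lemma Legendre_cong_power:
  assumes "prime p" "2 < p"
  shows "[Legendre a (int p) = a ^ (p ^ e * ((p - 1) div 2))] (mod int p ^ Suc e)"
proof -
  have odd: "odd (p ^ e)" using assms prime_odd_nat[of p] by auto
  have "Legendre a (int p) \<in> {-1, 0, 1}" by (simp add: Legendre_def)
  then have *: "Legendre a (int p) ^ (p ^ e) = Legendre a (int p)"
    using odd assms by (auto simp: power_0_left)
  have "[Legendre a (int p) ^ (p ^ e) = (a ^ ((p - 1) div 2)) ^ (p ^ e)] (mod int p ^ Suc e)"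
    using euler_criterion[OF assms] by (rule cong_power_prime_power)
  then show ?thesis unfolding * by (simp only: power_mult[symmetric] mult.commute[of "p ^ e"])
qed

lemma fermat_int_Suc:
  fixes a :: int
  assumes "prime p"
  shows "[a ^ ((p - 1) * k + 1) = a] (mod int p)"
proof (cases "int p dvd a")
  case True
  then have "[a = 0] (mod int p)" by (simp add: cong_0_iff)
  moreover from this have "[a ^ ((p - 1) * k + 1) = 0] (mod int p)"
    using True by (simp add: cong_0_iff)
  ultimately show ?thesis using cong_sym cong_trans by blast
next
  case False
  have "[(a ^ (p - 1)) ^ k * a = 1 ^ k * a] (mod int p)"
    using fermat_int[OF assms False] by (intro cong_mult cong_pow cong_refl)
  then show ?thesis by (simp only: power_add power_mult power_one power_one_right mult_1)
qed

lemma power_prime_power_cong_self: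
  fixes a :: int
  assumes "prime p"
  shows "[a ^ (p ^ e) = a] (mod int p)"
proof (induction e)
  case (Suc e)
  have "p = (p - 1) * 1 + 1" using assms prime_gt_0_nat[of p] by simp
  then have "[(a ^ (p ^ e)) ^ p = a ^ (p ^ e)] (mod int p)"
    using fermat_int_Suc[OF assms, of "a ^ (p ^ e)" 1] by simp
  then show ?case using Suc cong_trans by (simp add: power_mult[symmetric] mult.commute) blast
qed simp

lemma sum_residues_affine:
  fixes f :: "int \<Rightarrow> int" and u v :: int
  assumes "prime p" "\<not> int p dvd u"
    and "\<And>a b. [a = b] (mod int p) \<Longrightarrow> [f a = f b] (mod M)"
  shows "[(\<Sum>a\<in>{0..<int p}. f (u * a + v)) = (\<Sum>a\<in>{0..<int p}. f a)] (mod M)"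
proof (rule sum_residues_reindex[OF _ assms(3)])
  fix a b assume ab: "a \<in> {0..<int p}" "b \<in> {0..<int p}" "[u * a + v = u * b + v] (mod int p)"
  then have "[u * a = u * b] (mod int p ^ 1)" by (simp add: cong_add_rcancel)
  then have "[a = b] (mod int p)" using cong_mult_cancel_prime_power[OF assms(1,2), of a b 1] by simp
  then show "a = b" using ab by (simp add: cong_def)
qed (use assms(1) prime_gt_0_nat in auto)

section \<open>Sums of Legendre symbols over all residues\<close>

context
  fixes p n :: nat
  assumes prime: "prime p" and p_gt_2: "2 < p" and n: "p = 2 * n + 1"
begin

abbreviation (input) chi :: "int \<Rightarrow> int" where "chi a \<equiv> Legendre a (int p)"

lemma sum_Legendre: "[(\<Sum>a\<in>{0..<int p}. chi a) = 0] (mod int p ^ Suc e)"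
proof -
  have n': "(p - 1) div 2 = n" "0 < n" "\<not> p - 1 dvd n" using n p_gt_2 by (auto dest: dvd_imp_le)
  have "[(\<Sum>a\<in>{0..<int p}. chi a) = (\<Sum>a\<in>{0..<int p}. a ^ (p ^ e * n))] (mod int p ^ Suc e)"
    using Legendre_cong_power[OF prime p_gt_2] unfolding n' by (intro cong_sum)
  also have "[(\<Sum>a\<in>{0..<int p}. a ^ (p ^ e * n)) = 0] (mod int p ^ Suc e)"
    using power_sum_teichmuller[OF prime n'(2), of e] n'(3) by simp
  finally show ?thesis .
qed

lemma sum_Legendre_affine:
  "\<not> int p dvd u \<Longrightarrow> [(\<Sum>a\<in>{0..<int p}. chi (u * a + v)) = 0] (mod int p ^ Suc e)"
proof (rule cong_trans[OF sum_residues_affine[OF prime, of u chi] sum_Legendre])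
  fix a b :: int assume "[a = b] (mod int p)"
  then show "[chi a = chi b] (mod int p ^ Suc e)" by (simp add: Legendre_cong)
qed

text \<open>For \<open>c = 1\<close> the summand is a square. Otherwise put
  \<open>b = 1 - 1 / d\<close>: up to a square factor the summand becomes the Legendre symbol of
  \<open>(1 - c) * d + c\<close>, which is linear in \<open>d\<close> and sums to zero. The residue
  \<open>d = 0\<close> has no inverse; its summand is 0, hence the subtraction of
  \<open>chi c\<close>.\<close>

lemma sum_Legendre_quadratic:
  assumes "c \<in> {0<..<int p}"
  shows "[(\<Sum>b\<in>{0..<int p}. chi (1 - b * c) * chi (1 - b)) = (if c = 1 then int p else 0) - chi c]
    (mod int p ^ Suc e)"
proof (cases "c = 1")
  case True
  have "(\<Sum>b\<in>{0..<int p}. chi (1 - b * c) * chi (1 - b)) = (\<Sum>b\<in>{0..<int p}. if b = 1 then 0 else 1)"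
  proof (rule sum.cong)
    fix b assume b: "b \<in> {0..<int p}"
    show "chi (1 - b * c) * chi (1 - b) = (if b = 1 then 0 else 1)"
    proof (cases "b = 1")
      case False
      have "\<not> int p dvd 1 - b"
      proof
        assume "int p dvd 1 - b"
        moreover have "1 - b \<noteq> 0" using False by simp
        ultimately have "\<bar>int p\<bar> \<le> \<bar>1 - b\<bar>" by (rule dvd_imp_le_int[rotated])
        then show False using b p_gt_2 by auto
      qed
      then show ?thesis using False True Legendre_mult_self[OF prime p_gt_2] by simp
    qed (use True Legendre_eq_0_iff[of 0 "int p"] in simp)
  qed simp
  also have "\<dots> = (\<Sum>b\<in>{0..<int p} - {1}. 1)"
    by (rule sum.mono_neutral_cong_right) auto
  also have "\<dots> = int p - 1" using p_gt_2 by simp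
  finally show ?thesis using True p_gt_2 by (simp add: Legendre_1)
next
  case False
  define f where "f b = chi (1 - b * c) * chi (1 - b)" for b
  have f: "[f a = f b] (mod M)" if "[a = b] (mod int p)" for a b M
  proof -
    have "[1 - a * c = 1 - b * c] (mod int p)" "[1 - a = 1 - b] (mod int p)"
      using that by (auto intro!: cong_diff cong_mult)
    then have "f a = f b" unfolding f_def by (simp only: Legendre_cong)
    then show ?thesis by simp
  qed
  have nc: "\<not> int p dvd 1 - c"
  proof
    assume "int p dvd 1 - c"
    moreover have "1 - c \<noteq> 0" using False by simp
    ultimately have "\<bar>int p\<bar> \<le> \<bar>1 - c\<bar>" by (rule dvd_imp_le_int[rotated])
    then show False using assms by auto
  qed
  \<comment> \<open>Inversion modulo \<open>p\<close> is realised as the power \<open>p - 2\<close>.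
    Applied twice it is the identity, which gives the injectivity for the substitution.\<close>
  have pp: "(p - 2) * (p - 2) = (p - 1) * (p - 3) + 1"
  proof -
    obtain k where "p = k + 3" using p_gt_2 less_imp_add_positive[of 2 p] le_Suc_ex[of 3 p] by auto
    then show ?thesis by (simp add: algebra_simps)
  qed
  have "[(\<Sum>b\<in>{0..<int p}. f (1 - b ^ (p - 2))) = (\<Sum>b\<in>{0..<int p}. f b)] (mod int p ^ Suc e)"
  proof (rule sum_residues_reindex[OF _ f])
    fix a b assume ab: "a \<in> {0..<int p}" "b \<in> {0..<int p}"
      "[1 - a ^ (p - 2) = 1 - b ^ (p - 2)] (mod int p)"
    then have "[a ^ (p - 2) = b ^ (p - 2)] (mod int p)"
      using cong_diff[OF cong_refl[of 1] ab(3)] by simp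
    then have "[(a ^ (p - 2)) ^ (p - 2) = (b ^ (p - 2)) ^ (p - 2)] (mod int p)" by (rule cong_pow)
    then have "[a ^ ((p - 1) * (p - 3) + 1) = b ^ ((p - 1) * (p - 3) + 1)] (mod int p)"
      by (simp only: power_mult[symmetric] pp)
    then have "[a = b] (mod int p)"
      using fermat_int_Suc[OF prime] by (meson cong_sym cong_trans)
    then show "a = b" using ab by (simp add: cong_def)
  qed (use p_gt_2 in auto)
  moreover have "(\<Sum>b\<in>{0..<int p}. f (1 - b ^ (p - 2)))
      = (\<Sum>b\<in>{0..<int p}. chi ((1 - c) * b + c) - (if b = 0 then chi c else 0))"
  proof (rule sum.cong)
    fix d assume d: "d \<in> {0..<int p}"
    show "f (1 - d ^ (p - 2)) = chi ((1 - c) * d + c) - (if d = 0 then chi c else 0)"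
    proof (cases "d = 0")
      case True
      then show ?thesis using p_gt_2 Legendre_eq_0_iff[of 0 "int p"] by (simp add: f_def power_0_left)
    next
      case False
      have nd: "\<not> int p dvd d" using d False zdvd_not_zless by auto
      define d' where "d' = d ^ (p - 2)"
      have "d' * d = d ^ (p - 1)"
        unfolding d'_def power_Suc2[symmetric] using p_gt_2 by (simp add: Suc_diff_le numeral_2_eq_2 Suc_diff_Suc)
      then have dd: "[d' * d = 1] (mod int p)" using fermat_int[OF prime nd] by simp
      have nd': "\<not> int p dvd d'" unfolding d'_def using nd prime prime_dvd_power[of "int p" d "p - 2"] by auto
      have eq: "d' * ((1 - c) * d + c) - (1 - (1 - d') * c) = (1 - c) * (d' * d - 1)"
        by (simp add: algebra_simps)
      have "int p dvd (1 - c) * (d' * d - 1)" using dd by (simp add: cong_iff_dvd_diff)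
      then have "[d' * ((1 - c) * d + c) = 1 - (1 - d') * c] (mod int p)"
        unfolding cong_iff_dvd_diff eq .
      then have "chi (1 - (1 - d') * c) = chi d' * chi ((1 - c) * d + c)"
        by (simp only: Legendre_cong[symmetric] Legendre_mult[OF prime p_gt_2])
      then have "f (1 - d') = (chi d' * chi d') * chi ((1 - c) * d + c)"
        by (simp add: f_def)
      then show ?thesis using Legendre_mult_self[OF prime p_gt_2 nd'] False by (simp add: d'_def)
    qed
  qed simp
  moreover have "(\<Sum>b\<in>{0..<int p}. chi ((1 - c) * b + c) - (if b = 0 then chi c else 0))
     = (\<Sum>b\<in>{0..<int p}. chi ((1 - c) * b + c)) - chi c"
    using p_gt_2 by (simp add: sum_subtractf)
  moreover have "[(\<Sum>b\<in>{0..<int p}. chi ((1 - c) * b + c)) - chi c = 0 - chi c] (mod int p ^ Suc e)"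
    by (intro cong_diff sum_Legendre_affine nc cong_refl)
  ultimately have "[0 - chi c = (\<Sum>b\<in>{0..<int p}. f b)] (mod int p ^ Suc e)"
    using cong_sym cong_trans by metis
  then show ?thesis using False unfolding f_def by (simp add: cong_sym)
qed

end

section \<open>Jacobi sums modulo \<open>p\<^sup>3\<close>\<close>

text \<open>Modulo \<open>p\<^sup>3\<close>, the power \<open>a\<^bsup>p\<^sup>2\<^esup>\<close> is the Teichmueller representative of \<open>a\<close>, so \<open>a \<mapsto> a\<^bsup>p\<^sup>2 k\<^esup>\<close>
  is the \<open>k\<close>-th power of a generating character.\<close>

definition jacobi_sum :: "nat \<Rightarrow> nat \<Rightarrow> int" where
  "jacobi_sum p k = (\<Sum>a\<in>{0..<int p}. Legendre (1 - a) (int p) * a ^ (p\<^sup>2 * k))"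

context
  fixes p r :: nat
  assumes prime: "prime p" and r: "p = 6 * r + 1" and r_pos: "0 < r"
begin

abbreviation (input) "M \<equiv> int p ^ 3"

lemma six_r_plus_1_facts: "2 < p" "p = 2 * (3 * r) + 1" "(p - 1) div 2 = 3 * r"
  using r r_pos by auto

lemma power_sum_mod_M:
  assumes "0 < k"
  shows "[(\<Sum>a\<in>{0..<int p}. a ^ (p\<^sup>2 * k)) = (if p - 1 dvd k then int p - 1 else 0)] (mod M)"
  using power_sum_teichmuller[OF prime assms, of 2] by (simp add: numeral_3_eq_3 power2_eq_square)

lemma cong_prime_power_M: "[a = b] (mod int p) \<Longrightarrow> [a ^ (p\<^sup>2 * k) = b ^ (p\<^sup>2 * k)] (mod M)"
  unfolding power_mult using cong_pow[OF cong_power_prime_power[of a b p 2], of k]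
  by (simp only: numeral_3_eq_3 numeral_2_eq_2)

lemma nonzero_residue: "a \<in> {0..<int p} \<Longrightarrow> a \<noteq> 0 \<Longrightarrow> \<not> int p dvd a"
  using zdvd_not_zless by auto

lemma power_p_minus_1:
  assumes "a \<in> {0..<int p}" "a \<noteq> 0"
  shows "[a ^ (p\<^sup>2 * (p - 1)) = 1] (mod M)"
  using cong_power_prime_power[OF fermat_int[OF prime nonzero_residue[OF assms]], of 2]
  by (simp add: power_mult[symmetric] mult.commute numeral_3_eq_3 numeral_2_eq_2)

text \<open>For fixed nonzero \<open>b\<close>, substituting \<open>b * c\<close> for the variable
  of the second sum makes the two conjugate cubic characters of \<open>b\<close> cancel. After
  exchanging the sums, the sum over \<open>b\<close> is that of
  \<open>sum_Legendre_quadratic\<close>, and of the remaining terms only \<open>c = 1\<close>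
  contributes, namely \<open>p\<close>.\<close>

lemma jacobi_sum_mult: "[jacobi_sum p (4 * r) * jacobi_sum p (2 * r) = int p] (mod M)"
proof -
  let ?R = "{0..<int p}"
  let ?q = "p\<^sup>2 * (2 * r)" and ?q2 = "p\<^sup>2 * (4 * r)"
  let ?L = "\<lambda>a. Legendre a (int p)"
  have cubes: "[b ^ ?q2 * b ^ ?q = 1] (mod M)" if "b \<in> ?R" "b \<noteq> 0" for b
  proof -
    have "b ^ ?q2 * b ^ ?q = b ^ (p\<^sup>2 * (p - 1))"
      unfolding power_add[symmetric] by (rule arg_cong[of _ _ "\<lambda>k. b ^ k"]) (use r in \<open>simp add: algebra_simps\<close>)
    then show ?thesis using power_p_minus_1[OF that] by simp
  qed
  have inner: "[?L (1 - b) * b ^ ?q2 * jacobi_sum p (2 * r)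
      = (if b = 0 then 0 else 1) * (\<Sum>c\<in>?R. c ^ ?q * (?L (1 - b * c) * ?L (1 - b)))] (mod M)"
    if b: "b \<in> ?R" for b
  proof (cases "b = 0")
    case False
    have "[(\<Sum>c\<in>?R. ?L (1 - (b * c + 0)) * (b * c + 0) ^ ?q) = jacobi_sum p (2 * r)] (mod M)"
      unfolding jacobi_sum_def
    proof (rule sum_residues_affine[where f = "\<lambda>a. ?L (1 - a) * a ^ ?q", OF prime nonzero_residue[OF b False]])
      fix x y :: int assume xy: "[x = y] (mod int p)"
      then have "[1 - x = 1 - y] (mod int p)" by (intro cong_diff cong_refl)
      then show "[?L (1 - x) * x ^ ?q = ?L (1 - y) * y ^ ?q] (mod M)"
        using cong_prime_power_M[OF xy] Legendre_cong by (intro cong_mult) auto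
    qed
    then have "[jacobi_sum p (2 * r) = (\<Sum>c\<in>?R. ?L (1 - b * c) * (b * c) ^ ?q)] (mod M)"
      by (simp only: add_0_right cong_sym)
    then have "[?L (1 - b) * b ^ ?q2 * jacobi_sum p (2 * r)
        = ?L (1 - b) * b ^ ?q2 * (\<Sum>c\<in>?R. ?L (1 - b * c) * (b * c) ^ ?q)] (mod M)"
      by (intro cong_mult cong_refl)
    also have "?L (1 - b) * b ^ ?q2 * (\<Sum>c\<in>?R. ?L (1 - b * c) * (b * c) ^ ?q)
        = (b ^ ?q2 * b ^ ?q) * (\<Sum>c\<in>?R. c ^ ?q * (?L (1 - b * c) * ?L (1 - b)))"
      unfolding sum_distrib_left power_mult_distrib by (intro sum.cong refl) (simp only: mult_ac)
    also have "[\<dots> = 1 * (\<Sum>c\<in>?R. c ^ ?q * (?L (1 - b * c) * ?L (1 - b)))] (mod M)"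
      by (intro cong_mult cubes b False cong_refl)
    finally show ?thesis using False by simp
  qed (use r r_pos in \<open>simp add: power_0_left\<close>)
  have step1: "[jacobi_sum p (4 * r) * jacobi_sum p (2 * r) = (\<Sum>b\<in>?R. (if b = 0 then 0 else 1) * (\<Sum>c\<in>?R. c ^ ?q * (?L (1 - b * c) * ?L (1 - b))))] (mod M)"
    unfolding jacobi_sum_def[of p "4 * r"] sum_distrib_right by (rule cong_sum) (rule inner)
  \<comment> \<open>The excluded index \<open>b = 0\<close> would contribute \<open>c ^ ?q\<close>,
    hence the \<open>- 1\<close>.\<close>
  have step2: "(\<Sum>b\<in>?R. (if b = 0 then 0 else 1) * (\<Sum>c\<in>?R. c ^ ?q * (?L (1 - b * c) * ?L (1 - b))))
     = (\<Sum>c\<in>?R. c ^ ?q * ((\<Sum>b\<in>?R. ?L (1 - b * c) * ?L (1 - b)) - 1))"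
  proof -
    have 0: "0 \<in> ?R" using r by simp
    have "(\<Sum>b\<in>?R. (if b = 0 then 0 else 1) * (\<Sum>c\<in>?R. c ^ ?q * (?L (1 - b * c) * ?L (1 - b))))
       = (\<Sum>c\<in>?R. \<Sum>b\<in>?R. (if b = 0 then 0 else 1) * (c ^ ?q * (?L (1 - b * c) * ?L (1 - b))))"
      unfolding sum_distrib_left by (rule sum.swap)
    also have "\<dots> = (\<Sum>c\<in>?R. \<Sum>b\<in>?R. c ^ ?q * (?L (1 - b * c) * ?L (1 - b)) - (if b = 0 then c ^ ?q else 0))"
      using Legendre_1[of "int p"] six_r_plus_1_facts(1) by (intro sum.cong refl) auto
    also have "\<dots> = (\<Sum>c\<in>?R. c ^ ?q * ((\<Sum>b\<in>?R. ?L (1 - b * c) * ?L (1 - b)) - 1))"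
      using 0 by (intro sum.cong refl) (simp add: sum_subtractf sum_distrib_left right_diff_distrib)
    finally show ?thesis .
  qed
  \<comment> \<open>The Legendre symbol of \<open>c\<close> is \<open>c ^ (p^2 * (3 * r))\<close>
    modulo \<open>M\<close>, which raises the exponent \<open>2 * r\<close> to
    \<open>5 * r\<close>.\<close>
  have step3: "[(\<Sum>c\<in>?R. c ^ ?q * ((\<Sum>b\<in>?R. ?L (1 - b * c) * ?L (1 - b)) - 1))
      = (\<Sum>c\<in>?R. (if c = 1 then int p else 0) - c ^ (p\<^sup>2 * (5 * r)) - c ^ ?q)] (mod M)"
  proof (rule cong_sum)
    fix c assume c: "c \<in> ?R"
    show "[c ^ ?q * ((\<Sum>b\<in>?R. ?L (1 - b * c) * ?L (1 - b)) - 1)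
       = (if c = 1 then int p else 0) - c ^ (p\<^sup>2 * (5 * r)) - c ^ ?q] (mod M)"
    proof (cases "c = 0")
      case False
      then have c': "c \<in> {0<..<int p}" using c by auto
      have "[(\<Sum>b\<in>?R. ?L (1 - b * c) * ?L (1 - b)) = (if c = 1 then int p else 0) - ?L c] (mod int p ^ Suc 2)"
        by (rule sum_Legendre_quadratic[OF prime six_r_plus_1_facts(1,2) c'])
      moreover have "[?L c = c ^ (p ^ 2 * ((p - 1) div 2))] (mod int p ^ Suc 2)"
        by (rule Legendre_cong_power[OF prime six_r_plus_1_facts(1)])
      ultimately have "[(\<Sum>b\<in>?R. ?L (1 - b * c) * ?L (1 - b)) = (if c = 1 then int p else 0) - c ^ (p\<^sup>2 * (3 * r))] (mod M)"
        unfolding six_r_plus_1_facts(3) numeral_3_eq_3 numeral_2_eq_2[symmetric]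
        using cong_trans cong_diff cong_refl by blast
      then have "[c ^ ?q * ((\<Sum>b\<in>?R. ?L (1 - b * c) * ?L (1 - b)) - 1)
        = c ^ ?q * (((if c = 1 then int p else 0) - c ^ (p\<^sup>2 * (3 * r))) - 1)] (mod M)"
        by (intro cong_mult cong_diff cong_refl)
      also have "c ^ ?q * (((if c = 1 then int p else 0) - c ^ (p\<^sup>2 * (3 * r))) - 1)
         = (if c = 1 then int p else 0) - c ^ ?q * c ^ (p\<^sup>2 * (3 * r)) - c ^ ?q"
        by (simp add: algebra_simps)
      also have "c ^ ?q * c ^ (p\<^sup>2 * (3 * r)) = c ^ (p\<^sup>2 * (5 * r))"
        by (simp add: algebra_simps flip: power_add)
      finally show ?thesis .
    qed (use r r_pos in \<open>simp add: power_0_left\<close>)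
  qed
  have step4: "(\<Sum>c\<in>?R. (if c = 1 then int p else 0) - c ^ (p\<^sup>2 * (5 * r)) - c ^ ?q)
     = int p - (\<Sum>c\<in>?R. c ^ (p\<^sup>2 * (5 * r))) - (\<Sum>c\<in>?R. c ^ ?q)"
    using six_r_plus_1_facts(1) by (simp add: sum_subtractf)
  have step5: "[int p - (\<Sum>c\<in>?R. c ^ (p\<^sup>2 * (5 * r))) - (\<Sum>c\<in>?R. c ^ ?q) = int p - 0 - 0] (mod M)"
  proof -
    have "\<not> p - 1 dvd 5 * r" "\<not> p - 1 dvd 2 * r" using r r_pos by (auto dest!: dvd_imp_le)
    then show ?thesis using power_sum_mod_M[of "5 * r"] power_sum_mod_M[of "2 * r"] r_pos
      by (intro cong_diff cong_refl) auto
  qed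
  show ?thesis
    using cong_trans[OF step1[unfolded step2] cong_trans[OF step3[unfolded step4] step5]] by simp
qed

text \<open>The integers \<open>T\<close> and \<open>b\<close> play the roles of the trace and of the coordinate of the
  square root of -3 of a Jacobi sum of norm \<open>p\<close>.  The equation for them is an honest equation
  and not just a congruence, since it holds modulo \<open>p\<^sup>3\<close> and both sides are less than \<open>p\<^sup>3\<close>.\<close>

lemma jacobi_sum_add:
  "\<exists>X Y. int p = X\<^sup>2 + 3 * Y\<^sup>2 \<and> [jacobi_sum p (4 * r) + jacobi_sum p (2 * r) = 2 * X] (mod M)"
proof -
  let ?R = "{0..<int p}"
  let ?q = "p\<^sup>2 * (2 * r)" and ?q2 = "p\<^sup>2 * (4 * r)"
  let ?L = "\<lambda>a. Legendre a (int p)"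
  \<comment> \<open>The nonzero cubic residues, as the kernel of the cubic character.\<close>
  define A where "A = {a \<in> ?R. [a ^ ?q = 1] (mod M)}"
  have "A \<subseteq> ?R" by (auto simp: A_def)
  then have fA: "finite A" "A \<subseteq> ?R" by (auto intro: finite_subset)
  have p3: "[a = b] (mod int p)" if "[a = b] (mod M)" for a b
    using that by (rule cong_dvd_modulus) (simp add: dvd_power)
  have sq: "a ^ ?q2 = a ^ ?q * a ^ ?q" for a :: int
    unfolding power_add[symmetric] by (rule arg_cong[of _ _ "\<lambda>k. a ^ k"]) simp
  have zA: "a \<noteq> 0" if "a \<in> A" for a
  proof
    assume "a = 0"
    then have "[0 = 1] (mod int p)" using that p3[of 0 1] r_pos prime_gt_0_nat[OF prime]
      by (simp add: A_def power_0_left)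
    then show False using six_r_plus_1_facts(1) by (simp add: cong_def)
  qed
  \<comment> \<open>Off the kernel the character value is a primitive cube root of unity:
    \<open>?z - 1\<close> is a unit even modulo \<open>p\<close>, so it cancels from
    \<open>?z^3 - 1\<close>.\<close>
  have root: "[a ^ ?q * a ^ ?q + a ^ ?q + 1 = 0] (mod M)" if a: "a \<in> ?R" "a \<noteq> 0" "a \<notin> A" for a
  proof -
    let ?z = "a ^ ?q"
    have "?z * ?z * ?z = a ^ (p\<^sup>2 * (p - 1))"
      unfolding power_add[symmetric] by (rule arg_cong[of _ _ "\<lambda>k. a ^ k"]) (use r in \<open>simp add: algebra_simps\<close>)
    then have z3: "[?z * ?z * ?z = 1] (mod M)" using power_p_minus_1 a by simp
    have "[?z = a ^ (2 * r)] (mod int p)"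
      unfolding power_mult[of a "p\<^sup>2" "2 * r"]
      using power_prime_power_cong_self[OF prime, of a 2] by (rule cong_pow)
    moreover have "\<not> [a ^ (2 * r) = 1] (mod int p)"
    proof
      assume "[a ^ (2 * r) = 1] (mod int p)"
      then have "[(a ^ (2 * r)) ^ (p ^ 2) = 1 ^ (p ^ 2)] (mod int p ^ Suc 2)"
        by (rule cong_power_prime_power)
      then have "a \<in> A" using a by (simp add: A_def power_mult[symmetric] mult.commute mult.left_commute numeral_3_eq_3 numeral_2_eq_2)
      then show False using a by simp
    qed
    ultimately have "\<not> [?z = 1] (mod int p)" by (meson cong_sym cong_trans)
    then have nz: "\<not> int p dvd ?z - 1" by (simp add: cong_iff_dvd_diff)
    have e: "(?z - 1) * (?z * ?z + ?z + 1) - (?z - 1) * 0 = ?z * ?z * ?z - 1" by (simp add: algebra_simps)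
    have "[(?z - 1) * (?z * ?z + ?z + 1) = (?z - 1) * 0] (mod M)"
      using z3 unfolding cong_iff_dvd_diff e .
    then show ?thesis by (rule cong_mult_cancel_prime_power[OF prime nz])
  qed
  \<comment> \<open>The three characters of order dividing 3 add up to 3 on the cubic residues and
    to 0 elsewhere; the conditional is the trivial one.\<close>
  have trace: "[(if a = 0 then 0 else 1) + a ^ ?q + a ^ ?q2 = (if a \<in> A then 3 else 0)] (mod M)" if a: "a \<in> ?R" for a
  proof -
    consider "a = 0" | "a \<noteq> 0" "a \<in> A" | "a \<noteq> 0" "a \<notin> A" by blast
    then show ?thesis
    proof cases
      case 1
      then show ?thesis using zA r_pos prime_gt_0_nat[OF prime] by (auto simp: power_0_left)
    next
      case 2
      then have z: "[a ^ ?q = 1] (mod M)" by (simp add: A_def)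
      have "[1 + a ^ ?q + a ^ ?q * a ^ ?q = 1 + 1 + 1 * 1] (mod M)"
        by (intro cong_add cong_mult z cong_refl)
      then show ?thesis using 2 unfolding sq by simp
    next
      case 3
      then show ?thesis using root[OF a] unfolding sq by (simp add: add_ac)
    qed
  qed
  \<comment> \<open>This recovers exact integer equations from congruences modulo
    \<open>p^3\<close>, first for the number of cubic residues and later for the norm equation,
    whose terms are of order \<open>p^2\<close>.\<close>
  have bound3: "x = y" if "[x = y] (mod M)" "\<bar>x - y\<bar> < M" for x y :: int
    using that dvd_imp_le_int[of "x - y" M] by (fastforce simp: cong_iff_dvd_diff)
  have p7: "7 \<le> int p" using r r_pos by simp
  then have "7 * (int p * int p) \<le> int p * (int p * int p)" by (intro mult_right_mono) auto
  then have M7: "7 * (int p * int p) \<le> M" by (simp add: numeral_3_eq_3)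
  have pp7: "7 * int p \<le> int p * int p" using p7 by (intro mult_right_mono) auto
  have powersum0: "[(\<Sum>a\<in>?R. a ^ ?q) = 0] (mod M)" "[(\<Sum>a\<in>?R. a ^ ?q2) = 0] (mod M)"
  proof -
    have "\<not> p - 1 dvd 4 * r" "\<not> p - 1 dvd 2 * r" using r r_pos by (auto dest!: dvd_imp_le)
    then show "[(\<Sum>a\<in>?R. a ^ ?q) = 0] (mod M)" "[(\<Sum>a\<in>?R. a ^ ?q2) = 0] (mod M)"
      using power_sum_mod_M[of "4 * r"] power_sum_mod_M[of "2 * r"] r_pos by auto
  qed
  have cardA: "card A = 2 * r"
  proof -
    have c1: "[(\<Sum>a\<in>?R. (if a = 0 then 0 else 1) + a ^ ?q + a ^ ?q2) = (\<Sum>a\<in>?R. if a \<in> A then 3 else 0)] (mod M)"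
      by (intro cong_sum trace)
    have e1: "(\<Sum>a\<in>?R. if a \<in> A then 3 else (0::int)) = 3 * int (card A)"
    proof -
      have "(\<Sum>a\<in>?R. if a \<in> A then 3 else (0::int)) = (\<Sum>a\<in>A. 3)"
        using fA by (intro sum.mono_neutral_cong_right) auto
      then show ?thesis by simp
    qed
    have e2: "(\<Sum>a\<in>?R. (if a = 0 then 0 else 1) + a ^ ?q + a ^ ?q2)
       = (int p - 1) + (\<Sum>a\<in>?R. a ^ ?q) + (\<Sum>a\<in>?R. a ^ ?q2)"
    proof -
      have "(\<Sum>a\<in>?R. if a = 0 then 0 else (1::int)) = (\<Sum>a\<in>?R - {0}. 1)"
        by (intro sum.mono_neutral_cong_right) auto
      also have "\<dots> = int p - 1" using p7 by simp
      finally show ?thesis by (simp add: sum.distrib)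
    qed
    have c2: "[(int p - 1) + (\<Sum>a\<in>?R. a ^ ?q) + (\<Sum>a\<in>?R. a ^ ?q2) = (int p - 1) + 0 + 0] (mod M)"
      by (intro cong_add cong_refl powersum0)
    have "[3 * int (card A) = int p - 1 + 0 + 0] (mod M)"
      by (rule cong_trans[OF cong_sym[OF c1[unfolded e1 e2]] c2])
    then have "[3 * int (card A) = int p - 1] (mod M)" by simp
    moreover have "int (card A) \<le> int p" using card_mono[OF _ fA(2)] by simp
    then have "\<bar>3 * int (card A) - (int p - 1)\<bar> < M" using M7 pp7 p7 by linarith
    ultimately have "3 * int (card A) = int p - 1" by (rule bound3)
    then show ?thesis using r by simp
  qed
  define N where "N = (\<Sum>a\<in>A. ?L (1 - a))"
  \<comment> \<open>The trivial character, without its value at 0, contributes \<open>- 1\<close> to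
    the sum over all three characters; the summand 1 compensates for it.\<close>
  define T where "T = 3 * N + 1"
  have J_trace: "[jacobi_sum p (4 * r) + jacobi_sum p (2 * r) = T] (mod M)"
  proof -
    have c1: "[(\<Sum>a\<in>?R. ?L (1 - a) * ((if a = 0 then 0 else 1) + a ^ ?q + a ^ ?q2))
        = (\<Sum>a\<in>?R. ?L (1 - a) * (if a \<in> A then 3 else 0))] (mod M)"
      by (intro cong_sum cong_mult trace cong_refl)
    have e1: "(\<Sum>a\<in>?R. ?L (1 - a) * (if a \<in> A then 3 else 0)) = 3 * N"
    proof -
      have "(\<Sum>a\<in>?R. ?L (1 - a) * (if a \<in> A then 3 else 0)) = (\<Sum>a\<in>A. ?L (1 - a) * 3)"
        using fA by (intro sum.mono_neutral_cong_right) auto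
      then show ?thesis by (simp add: N_def sum_distrib_left mult.commute)
    qed
    have e2: "(\<Sum>a\<in>?R. ?L (1 - a) * ((if a = 0 then 0 else 1) + a ^ ?q + a ^ ?q2))
       = (\<Sum>a\<in>?R. ?L (1 - a)) - 1 + jacobi_sum p (2 * r) + jacobi_sum p (4 * r)"
    proof -
      have "(\<Sum>a\<in>?R. ?L (1 - a) * (if a = 0 then 0 else 1)) = (\<Sum>a\<in>?R. ?L (1 - a) - (if a = 0 then 1 else 0))"
        using Legendre_1[of "int p"] six_r_plus_1_facts(1) by (intro sum.cong) auto
      also have "\<dots> = (\<Sum>a\<in>?R. ?L (1 - a)) - 1" using p7 by (simp add: sum_subtractf)
      finally show ?thesis by (simp add: jacobi_sum_def distrib_left sum.distrib)
    qed
    have c2: "[(\<Sum>a\<in>?R. ?L (1 - a)) = 0] (mod M)"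
    proof -
      have "\<not> int p dvd -1" using p7 by simp
      then have "[(\<Sum>a\<in>?R. ?L ((-1) * a + 1)) = 0] (mod int p ^ Suc 2)"
        by (rule sum_Legendre_affine[OF prime six_r_plus_1_facts(1,2)])
      then show ?thesis by (simp add: numeral_3_eq_3 numeral_2_eq_2)
    qed
    have "[(\<Sum>a\<in>?R. ?L (1 - a)) - 1 + jacobi_sum p (2 * r) + jacobi_sum p (4 * r) - (\<Sum>a\<in>?R. ?L (1 - a)) + 1
       = 3 * N - 0 + 1] (mod M)"
      by (rule cong_add[OF cong_diff[OF c1[unfolded e1 e2] c2] cong_refl])
    then show ?thesis by (simp add: T_def algebra_simps)
  qed
  obtain g where g: "g \<in> ?R" "g \<noteq> 0" "g \<notin> A"
  proof -
    have "card (?R - {0}) = 6 * r" using r by simp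
    then have "\<not> ?R - {0} \<subseteq> A" using card_mono[OF fA(1), of "?R - {0}"] cardA r_pos by auto
    then show ?thesis using that by blast
  qed
  \<comment> \<open>With a primitive cube root of unity \<open>w\<close>, the difference
    \<open>w - w * w\<close> is a square root of -3 modulo \<open>M\<close>.\<close>
  define w where "w = g ^ ?q"
  define \<delta> where "\<delta> = w - w * w"
  have w: "[w * w + w + 1 = 0] (mod M)" using root[OF g] by (simp add: w_def)
  then have w': "M dvd w * w + w + 1" by (simp add: cong_0_iff)
  have delta2: "[\<delta> * \<delta> = - 3] (mod M)"
  proof -
    have "\<delta> * \<delta> - (- 3) = (w * w - 3 * w + 3) * (w * w + w + 1)"
      by (simp add: \<delta>_def algebra_simps)
    then show ?thesis unfolding cong_iff_dvd_diff using w' by simp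
  qed
  have ndvd3: "\<not> int p dvd 3" using p7 zdvd_imp_le[of "int p" 3] by auto
  have delta_unit: "\<not> int p dvd \<delta>"
  proof
    assume "int p dvd \<delta>"
    moreover have "[\<delta> * \<delta> = - 3] (mod int p)" by (rule p3[OF delta2])
    ultimately have "int p dvd - 3" using cong_dvd_iff dvd_mult by blast
    then show False using ndvd3 by simp
  qed
  \<comment> \<open>A character value is 0, 1 or one of the two primitive roots, so its difference
    with its conjugate is 0 or plus or minus \<delta>.\<close>
  have sign: "\<exists>s. \<bar>s\<bar> \<le> 1 \<and> [a ^ ?q - a ^ ?q2 = \<delta> * s] (mod M)" if a: "a \<in> ?R" for a
  proof -
    consider "a = 0" | "a \<in> A" | "a \<noteq> 0" "a \<notin> A" by blast
    then show ?thesis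
    proof cases
      case 1
      then show ?thesis using r_pos prime_gt_0_nat[OF prime] by (auto simp: power_0_left intro!: exI[of _ 0])
    next
      case 2
      then have z: "[a ^ ?q = 1] (mod M)" by (simp add: A_def)
      have "[a ^ ?q - a ^ ?q * a ^ ?q = 1 - 1 * 1] (mod M)"
        by (intro cong_diff cong_mult z cong_refl)
      then show ?thesis unfolding sq by (auto intro!: exI[of _ 0])
    next
      case 3
      define z where "z = a ^ ?q"
      have z: "M dvd z * z + z + 1" using root[OF a 3] by (simp add: z_def cong_0_iff)
      \<comment> \<open>Both \<open>z\<close> and \<open>w\<close> are roots of the same quadratic,
        the other root being \<open>- w - 1\<close>. The two factors are not both divisible by
        \<open>p\<close>, so one is a unit and \<open>M\<close> divides the other.\<close>
      have "(z - w) * (z + w + 1) = (z * z + z + 1) - (w * w + w + 1)" by (simp add: algebra_simps)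
      then have prod: "M dvd (z - w) * (z + w + 1)" using dvd_diff[OF z w'] by (simp only:)
      have goal: "\<exists>s. \<bar>s\<bar> \<le> 1 \<and> [z - z * z = \<delta> * s] (mod M)"
      proof (cases "int p dvd z - w")
        case True
        have "\<not> int p dvd z + w + 1"
        proof
          assume "int p dvd z + w + 1"
          then have "int p dvd (z + w + 1) - (z - w)" using True by (rule dvd_diff)
          moreover have "(z + w + 1) - (z - w) = 2 * w + 1" by simp
          ultimately have D: "int p dvd 2 * w + 1" by (simp only:)
          have "int p dvd w * w + w + 1" using w' dvd_trans[of "int p" M] by (simp add: numeral_3_eq_3)
          then have "int p dvd 2 * (w * w + w + 1) - w * (2 * w + 1) - (2 * w + 1)"
            by (rule dvd_diff[OF dvd_diff[OF dvd_mult dvd_mult[OF D]] D])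
          then have "int p dvd 1 - w" by (simp add: algebra_simps)
          then have "int p dvd (1 - w) * w" by simp
          then show False using delta_unit by (simp add: \<delta>_def algebra_simps)
        qed
        moreover have "[(z + w + 1) * z = (z + w + 1) * w] (mod M)"
          using prod by (simp add: cong_iff_dvd_diff algebra_simps)
        ultimately have "[z = w] (mod M)" using cong_mult_cancel_prime_power[OF prime] by blast
        then have "[z - z * z = w - w * w] (mod M)" by (intro cong_diff cong_mult)
        then show ?thesis by (auto intro!: exI[of _ 1] simp: \<delta>_def)
      next
        case False
        have "[(z - w) * (z + w + 1) = (z - w) * 0] (mod M)" using prod by (simp add: cong_0_iff)
        then have "M dvd z + w + 1" using cong_mult_cancel_prime_power[OF prime False] cong_0_iff by blast
        then have "M dvd 2 * (z + w + 1) - (z * z + z + 1) - (w * w + w + 1)"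
          using z w' by (intro dvd_diff dvd_mult)
        moreover have "z - z * z - \<delta> * (- 1) = 2 * (z + w + 1) - (z * z + z + 1) - (w * w + w + 1)"
          by (simp add: \<delta>_def)
        ultimately have "[z - z * z = \<delta> * (- 1)] (mod M)" by (simp only: cong_iff_dvd_diff)
        then show ?thesis by (intro exI[of _ "-1"]) simp
      qed
      then show ?thesis unfolding sq z_def .
    qed
  qed
  then obtain s where s: "\<And>a. a \<in> ?R \<Longrightarrow> \<bar>s a\<bar> \<le> 1"
    "\<And>a. a \<in> ?R \<Longrightarrow> [a ^ ?q - a ^ ?q2 = \<delta> * s a] (mod M)" by metis
  define b where "b = (\<Sum>a\<in>?R. ?L (1 - a) * s a)"
  have J_diff: "[jacobi_sum p (2 * r) - jacobi_sum p (4 * r) = \<delta> * b] (mod M)"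
  proof -
    have "jacobi_sum p (2 * r) - jacobi_sum p (4 * r) = (\<Sum>a\<in>?R. ?L (1 - a) * (a ^ ?q - a ^ ?q2))"
      by (simp add: jacobi_sum_def right_diff_distrib sum_subtractf)
    also have "[\<dots> = (\<Sum>a\<in>?R. ?L (1 - a) * (\<delta> * s a))] (mod M)"
      by (intro cong_sum cong_mult cong_refl s)
    also have "(\<Sum>a\<in>?R. ?L (1 - a) * (\<delta> * s a)) = \<delta> * b"
      by (simp add: b_def sum_distrib_left mult.left_commute)
    finally show ?thesis .
  qed
  have abs_sum: "\<bar>\<Sum>a\<in>B. f a\<bar> \<le> int (card B)" if "\<And>a. a \<in> B \<Longrightarrow> \<bar>f a\<bar> \<le> 1" for B :: "int set" and f :: "int \<Rightarrow> int"
  proof -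
    have "\<bar>\<Sum>a\<in>B. f a\<bar> \<le> (\<Sum>a\<in>B. \<bar>f a\<bar>)" by (rule sum_abs)
    also have "\<dots> \<le> (\<Sum>a\<in>B. 1)" using that by (rule sum_mono)
    finally show ?thesis by simp
  qed
  have "\<bar>b\<bar> \<le> int p"
  proof -
    have "\<bar>?L (1 - a) * s a\<bar> \<le> 1" if "a \<in> ?R" for a
      unfolding abs_mult using mult_mono[OF Legendre_abs_le s(1)[OF that], of "1 - a" "int p"] by simp
    then show ?thesis unfolding b_def using abs_sum[of ?R "\<lambda>a. ?L (1 - a) * s a"] by simp
  qed
  then have b2: "b\<^sup>2 \<le> int p * int p"
    using abs_le_square_iff[of b "int p"] by (simp add: power2_eq_square)
  have "\<bar>N\<bar> \<le> 2 * int r" unfolding N_def using abs_sum[of A "\<lambda>a. ?L (1 - a)"] Legendre_abs_le cardA by simp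
  then have "\<bar>T\<bar> \<le> int p" unfolding T_def using r by simp
  then have T2: "T\<^sup>2 \<le> int p * int p"
    using abs_le_square_iff[of T "int p"] by (simp add: power2_eq_square)
  \<comment> \<open>Four times the product of the Jacobi sums is the square of their sum minus the
    square of their difference.\<close>
  have norm: "T\<^sup>2 + 3 * b\<^sup>2 = 4 * int p"
  proof (rule bound3)
    let ?J1 = "jacobi_sum p (2 * r)" and ?J2 = "jacobi_sum p (4 * r)"
    have "[(?J2 + ?J1) * (?J2 + ?J1) - (?J1 - ?J2) * (?J1 - ?J2) = T * T - (\<delta> * b) * (\<delta> * b)] (mod M)"
      by (intro cong_diff cong_mult J_trace J_diff)
    also have "T * T - (\<delta> * b) * (\<delta> * b) = T * T - (\<delta> * \<delta>) * (b * b)" by (simp add: mult_ac)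
    also have "[\<dots> = T * T - (- 3) * (b * b)] (mod M)"
      by (intro cong_diff cong_mult delta2 cong_refl)
    also have "T * T - (- 3) * (b * b) = T\<^sup>2 + 3 * b\<^sup>2" by (simp add: power2_eq_square)
    finally have 1: "[4 * (?J2 * ?J1) = T\<^sup>2 + 3 * b\<^sup>2] (mod M)" by (simp add: algebra_simps)
    have "[4 * (?J2 * ?J1) = 4 * int p] (mod M)" by (intro cong_mult cong_refl jacobi_sum_mult)
    then show "[T\<^sup>2 + 3 * b\<^sup>2 = 4 * int p] (mod M)" using 1 cong_sym cong_trans by blast
    have "0 \<le> T\<^sup>2" "0 \<le> b\<^sup>2" by auto
    then show "\<bar>T\<^sup>2 + 3 * b\<^sup>2 - 4 * int p\<bar> < M" using T2 b2 M7 pp7 p7 by linarith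
  qed
  \<comment> \<open>This makes \<open>T\<close>, and then \<open>b\<close>, even, so the norm
    equation can be divided by 4. Each of the \<open>2 * r - 1\<close> terms with
    \<open>a \<noteq> 1\<close> is plus or minus 1.\<close>
  have "odd N"
  proof -
    have 1: "1 \<in> A" using p7 by (simp add: A_def)
    have "N = ?L 0 + (\<Sum>a\<in>A - {1}. ?L (1 - a))" unfolding N_def using fA 1 by (subst sum.remove) auto
    also have "?L 0 = 0" by (simp add: Legendre_eq_0_iff)
    finally have N: "N = (\<Sum>a\<in>A - {1}. ?L (1 - a))" by simp
    have "even (\<Sum>a\<in>A - {1}. ?L (1 - a) - 1)"
    proof (rule dvd_sum)
      fix a assume a: "a \<in> A - {1}"
      have "\<not> int p dvd 1 - a"
      proof
        assume "int p dvd 1 - a"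
        moreover have "1 - a \<noteq> 0" using a by simp
        ultimately have "\<bar>int p\<bar> \<le> \<bar>1 - a\<bar>" by (rule dvd_imp_le_int[rotated])
        then show False using a fA zA[of a] by auto
      qed
      then show "even (?L (1 - a) - 1)" by (simp add: Legendre_def cong_0_iff)
    qed
    then have "even (N - int (card (A - {1})))" by (simp add: N sum_subtractf)
    moreover have "card (A - {1}) = 2 * r - 1" using 1 fA cardA by simp
    moreover have "odd (int (2 * r - 1))" using r_pos by simp
    ultimately show ?thesis by simp
  qed
  then have evT: "even T" by (simp add: T_def)
  then have "even (4 * int p - T\<^sup>2)" by simp
  then have "even (3 * b\<^sup>2)" using norm by (metis add_diff_cancel_left')
  then have "even b" by simp
  then obtain Y where Y: "b = 2 * Y" by blast
  obtain X where X: "T = 2 * X" using evT by blast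
  have "int p = X\<^sup>2 + 3 * Y\<^sup>2" using norm by (simp add: X Y power_mult_distrib)
  then show ?thesis using J_trace X by blast
qed

end

text \<open>The prime divides \<open>(x * Y)^2 - (X * y)^2\<close>, hence
  \<open>x * V - X * y\<close> for \<open>V\<close> one of \<open>Y\<close> and \<open>- Y\<close>.
  By Brahmagupta's identity, \<open>p^2\<close> is a square plus
  \<open>3 * (x * V - X * y)^2\<close>, so this difference is zero; the two representations are then
  proportional.\<close>

lemma prime_repr_unique:
  fixes x y X Y :: int
  assumes "prime p" "int p = x\<^sup>2 + 3 * y\<^sup>2" "int p = X\<^sup>2 + 3 * Y\<^sup>2"
  shows "X\<^sup>2 = x\<^sup>2"
proof -
  have p0: "int p > 0" using assms(1) prime_gt_0_nat by simp
  have key: "x * V = X * y \<Longrightarrow> V\<^sup>2 = Y\<^sup>2 \<Longrightarrow> X\<^sup>2 = x\<^sup>2" for V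
  proof -
    assume 1: "x * V = X * y" and V: "V\<^sup>2 = Y\<^sup>2"
    have "x\<^sup>2 * Y\<^sup>2 = X\<^sup>2 * y\<^sup>2" using 1 V by (metis power_mult_distrib)
    then have "(int p - 3 * y\<^sup>2) * Y\<^sup>2 = (int p - 3 * Y\<^sup>2) * y\<^sup>2" using assms(2,3) by simp
    then have "int p * Y\<^sup>2 = int p * y\<^sup>2" by (simp add: algebra_simps)
    then show ?thesis using p0 assms by simp
  qed
  have case_dvd: "x * V = X * y" if "int p dvd x * V - X * y" "V\<^sup>2 = Y\<^sup>2" for V
  proof (rule ccontr)
    assume ne: "x * V \<noteq> X * y"
    have id: "int p * int p = (x * X + 3 * y * V)\<^sup>2 + 3 * (x * V - X * y)\<^sup>2"
    proof -
      have "int p * int p = (x\<^sup>2 + 3 * y\<^sup>2) * (X\<^sup>2 + 3 * V\<^sup>2)" using assms that by simp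
      then show ?thesis by (simp add: power2_eq_square algebra_simps)
    qed
    have "\<bar>int p\<bar> \<le> \<bar>x * V - X * y\<bar>" using that(1) ne by (intro dvd_imp_le_int) auto
    then have "(int p)\<^sup>2 \<le> (x * V - X * y)\<^sup>2" by (simp only: abs_le_square_iff)
    then have "3 * (int p * int p) \<le> int p * int p"
      unfolding power2_eq_square[of "int p"] using id zero_le_power2[of "x * X + 3 * y * V"] by linarith
    moreover have "int p * int p > 0" using p0 by simp
    ultimately show False by linarith
  qed
  have "(x * Y - X * y) * (x * (- Y) - X * y) = X\<^sup>2 * y\<^sup>2 - x\<^sup>2 * Y\<^sup>2"
    by (simp add: power2_eq_square algebra_simps)
  also have "\<dots> = (int p - 3 * Y\<^sup>2) * y\<^sup>2 - (int p - 3 * y\<^sup>2) * Y\<^sup>2" using assms by simp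
  also have "\<dots> = int p * (y\<^sup>2 - Y\<^sup>2)" by (simp add: algebra_simps)
  finally have "int p dvd (x * Y - X * y) * (x * (- Y) - X * y)" by simp
  then have "int p dvd x * Y - X * y \<or> int p dvd x * (- Y) - X * y"
    using assms(1) by (subst (asm) prime_dvd_mult_iff) auto
  then show ?thesis
  proof
    assume "int p dvd x * Y - X * y" then show ?thesis using case_dvd[of Y] key[of Y] by simp
  next
    assume "int p dvd x * (- Y) - X * y" then show ?thesis using case_dvd[of "- Y"] key[of "- Y"] by simp
  qed
qed

section \<open>The Jacobi sum modulo \<open>p\<^sup>2\<close>\<close>

lemma pcong_power_sum:
  assumes "prime p" "0 < t"
  shows "pcong p 2 (\<Sum>a\<in>{0..<int p}. of_int (a ^ p\<^sup>2) ^ t) (if p - 1 dvd t then of_nat p - 1 else 0)"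
proof -
  have "[(\<Sum>a\<in>{0..<int p}. a ^ (p\<^sup>2 * t)) = (if p - 1 dvd t then int p - 1 else 0)] (mod int p ^ 3)"
    using power_sum_teichmuller[OF assms, of 2] by (simp add: numeral_3_eq_3 numeral_2_eq_2)
  from pcong_le[OF assms(1) pcong_of_int[OF assms(1) this], of 2]
  have "pcong p 2 (of_int (\<Sum>a\<in>{0..<int p}. a ^ (p\<^sup>2 * t))) (of_int (if p - 1 dvd t then int p - 1 else 0))"
    by simp
  then show ?thesis by (simp add: power_mult if_distrib cong: if_cong)
qed

lemma dvd_small_multiple:
  fixes m t :: nat
  assumes "m dvd t" "0 < t" "t < 3 * m"
  shows "t = m \<or> t = 2 * m"
proof -
  obtain c where c: "t = m * c" using assms(1) by auto
  then have "c < 3" "0 < c" using assms by (auto simp: mult.commute)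
  then have "c = 1 \<or> c = 2" by auto
  then show ?thesis using c by auto
qed

context
  fixes p n :: nat
  assumes prime: "prime p" and n: "p = 2 * n + 1"
begin

lemma two_n_plus_1_facts: "odd p" "2 < p" "(p - 1) div 2 = n" "n < p" "0 < n"
proof -
  have "1 < p" using prime prime_gt_1_nat by blast
  then show "odd p" "2 < p" "(p - 1) div 2 = n" "n < p" "0 < n" using n by auto
qed

text \<open>Write \<open>s\<close> for \<open>a ^ p^2\<close> and \<open>h\<close> for the inner
  sum. Expanding \<open>(1 - s) ^ (p - 1)\<close> by \<open>binomial_pred_prime\<close> and
  multiplying by \<open>1 - s\<close> telescopes the geometric part to \<open>1 - s ^ p\<close>,
  which is \<open>1 - s\<close>. So \<open>(1 - s) ^ p\<close> is
  \<open>(1 - s) * (1 - p * h)\<close>, and its \<open>n\<close>-th power is the Legendre symbol by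
  Euler's criterion.\<close>

lemma Legendre_one_minus_pcong:
  "pcong p 2 (of_int (Legendre (1 - a) (int p)))
    ((1 - of_int (a ^ p\<^sup>2)) ^ n * (1 - of_nat p * (of_nat n * (\<Sum>k<p. hsum k * of_int (a ^ p\<^sup>2) ^ k))))"
proof -
  define s where "s = rat_of_int (a ^ p\<^sup>2)"
  define h where "h = (\<Sum>k<p. hsum k * s ^ k)"
  have sr: "s \<in> zp_ring p" using prime by (simp add: s_def del: of_int_power)
  have hr: "h \<in> zp_ring p" unfolding h_def using prime sr hsum_in_zp_ring[OF prime]
    by (intro zp_ring_sum zp_ring_mult zp_ring_power) auto
  have pr: "p - 1 + 1 = p" "Suc (p - 1) = p" using two_n_plus_1_facts by auto
  have sp: "pcong p 2 (s ^ p) s"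
  proof -
    have "[a ^ p = a] (mod int p)" using power_prime_power_cong_self[OF prime, of a 1] by simp
    then have "[(a ^ p) ^ (p ^ 2) = a ^ (p ^ 2)] (mod int p ^ Suc 2)" by (rule cong_power_prime_power)
    then have "[(a ^ p\<^sup>2) ^ p = a ^ p\<^sup>2] (mod int p ^ 3)"
      by (simp add: power_mult[symmetric] mult.commute numeral_3_eq_3 numeral_2_eq_2)
    from pcong_le[OF prime pcong_of_int[OF prime this], of 2]
    show ?thesis by (simp add: s_def)
  qed
  have pred: "(1 - s) ^ (p - 1) = (\<Sum>k<p. ((-1) ^ k * of_nat (p - 1 choose k)) * s ^ k)"
  proof -
    have "(1 - s) ^ (p - 1) = (- s + 1) ^ (p - 1)" by simp
    also have "\<dots> = (\<Sum>k\<le>p - 1. of_nat (p - 1 choose k) * (- s) ^ k * 1 ^ (p - 1 - k))"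
      by (rule binomial_ring)
    also have "\<dots> = (\<Sum>k\<le>p - 1. ((-1) ^ k * of_nat (p - 1 choose k)) * s ^ k)"
      by (intro sum.cong refl) (simp add: power_minus[of s])
    also have "{..p - 1} = {..<p}" using two_n_plus_1_facts by auto
    finally show ?thesis .
  qed
  have "pcong p 2 ((1 - s) ^ (p - 1)) (\<Sum>k<p. (1 + of_nat p * (- hsum k)) * s ^ k)"
    unfolding pred using sr
    by (intro pcong_sum pcong_mult pcong_refl prime binomial_pred_prime zp_ring_power) auto
  also have "(\<Sum>k<p. (1 + of_nat p * (- hsum k)) * s ^ k) = (\<Sum>k<p. s ^ k) - of_nat p * h"
    by (simp add: h_def sum_distrib_left algebra_simps sum_subtractf)
  finally have "pcong p 2 ((1 - s) * (1 - s) ^ (p - 1)) ((1 - s) * ((\<Sum>k<p. s ^ k) - of_nat p * h))"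
    using sr prime by (intro pcong_mult pcong_refl) auto
  moreover have "(1 - s) * (1 - s) ^ (p - 1) = (1 - s) ^ p"
    unfolding power_Suc[symmetric] pr ..
  moreover have "(1 - s) * ((\<Sum>k<p. s ^ k) - of_nat p * h) = (1 - s ^ p) - of_nat p * ((1 - s) * h)"
    unfolding one_diff_power_eq by (simp add: algebra_simps)
  ultimately have 1: "pcong p 2 ((1 - s) ^ p) ((1 - s ^ p) - of_nat p * ((1 - s) * h))" by simp
  have "pcong p 2 ((1 - s ^ p) - of_nat p * ((1 - s) * h)) ((1 - s) - of_nat p * ((1 - s) * h))"
    using sp sr hr prime by (intro pcong_diff pcong_refl) auto
  from pcong_trans[OF 1 this prime]
  have "pcong p 2 ((1 - s) ^ p) ((1 - s) * (1 + of_nat p * (- h)))" by (simp add: algebra_simps)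
  from pcong_power[OF prime this, of n]
  have 2: "pcong p 2 ((1 - s) ^ (p * n)) ((1 - s) ^ n * (1 + of_nat p * (- h)) ^ n)"
    by (simp only: power_mult power_mult_distrib)
  have "pcong p 2 ((1 + of_nat p * (- h)) ^ n) (1 + of_nat p * (of_nat n * (- h)))"
    using pcong_prod_one_plus[OF prime, of "{..<n}" "\<lambda>_. - h"] hr prime by simp
  then have 3: "pcong p 2 ((1 - s) ^ n * (1 + of_nat p * (- h)) ^ n) ((1 - s) ^ n * (1 + of_nat p * (of_nat n * (- h))))"
    using sr prime by (intro pcong_mult pcong_refl) auto
  have "[a ^ p\<^sup>2 = a] (mod int p)" by (rule power_prime_power_cong_self[OF prime])
  then have "[1 - a = 1 - a ^ p\<^sup>2] (mod int p)" by (intro cong_diff cong_refl) (rule cong_sym)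
  then have "Legendre (1 - a) (int p) = Legendre (1 - a ^ p\<^sup>2) (int p)" by (rule Legendre_cong)
  moreover have "[Legendre (1 - a ^ p\<^sup>2) (int p) = (1 - a ^ p\<^sup>2) ^ (p * n)] (mod int p ^ 2)"
    using Legendre_cong_power[OF prime two_n_plus_1_facts(2), of "1 - a ^ p\<^sup>2" 1, unfolded two_n_plus_1_facts(3)]
    by (simp add: numeral_2_eq_2)
  ultimately have "[Legendre (1 - a) (int p) = (1 - a ^ p\<^sup>2) ^ (p * n)] (mod int p ^ 2)" by (simp only:)
  from pcong_of_int[OF prime this]
  have 4: "pcong p 2 (of_int (Legendre (1 - a) (int p))) ((1 - s) ^ (p * n))"
    by (simp add: s_def)
  have "pcong p 2 (of_int (Legendre (1 - a) (int p))) ((1 - s) ^ n * (1 + of_nat p * (of_nat n * (- h))))"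
    by (rule pcong_trans[OF 4 pcong_trans[OF 2 3 prime] prime])
  then show ?thesis unfolding h_def s_def by simp
qed

text \<open>A power sum is \<open>- 1\<close> modulo \<open>p\<close> if its exponent is a multiple
  of \<open>p - 1\<close> and 0 otherwise. The exponent lies strictly between 0 and
  \<open>3 * (p - 1)\<close>, so it is \<open>p - 1\<close> or \<open>2 * (p - 1)\<close>, at
  \<open>k = q - i\<close> or \<open>k = p - 1 - (i - q)\<close>; reflection brings the second index
  to \<open>i - q\<close>. For \<open>i = q\<close> both occur, and both harmonic numbers are 0
  modulo \<open>p\<close>.\<close>

lemma hsum_power_sum:
  assumes "q \<le> n" "i \<le> n"
  shows "pcong p 1 (\<Sum>k<p. hsum k * (\<Sum>a\<in>{0..<int p}. of_int (a ^ p\<^sup>2) ^ (p - 1 - q + i + k)))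
    (- hsum (nat \<bar>int q - int i\<bar>))"
proof -
  let ?t = "\<lambda>k. p - 1 - q + i + k"
  have t0: "0 < ?t k" for k using assms n two_n_plus_1_facts by simp
  have d: "p - 1 dvd ?t k \<longleftrightarrow> ?t k = p - 1 \<or> ?t k = 2 * (p - 1)" if "k < p" for k
  proof
    assume "p - 1 dvd ?t k"
    then show "?t k = p - 1 \<or> ?t k = 2 * (p - 1)"
      by (rule dvd_small_multiple[OF _ t0]) (use that assms n two_n_plus_1_facts in auto)
  qed auto
  have "pcong p 1 (\<Sum>k<p. hsum k * (\<Sum>a\<in>{0..<int p}. of_int (a ^ p\<^sup>2) ^ ?t k))
     (\<Sum>k<p. hsum k * (if p - 1 dvd ?t k then - 1 else 0))"
  proof (intro pcong_sum pcong_mult pcong_refl prime)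
    fix k assume "k \<in> {..<p}"
    then show "hsum k \<in> zp_ring p" using hsum_in_zp_ring[OF prime] by simp
    have "pcong p 1 (if p - 1 dvd ?t k then of_nat p - 1 else 0) (if p - 1 dvd ?t k then - 1 else 0)"
      using pcongI[OF prime, of "- 1" 1 "of_nat p - 1" 1] prime pcong_refl[OF prime zero_in_zp_ring[OF prime], of 1] by simp
    moreover have "pcong p 1 (\<Sum>a\<in>{0..<int p}. of_int (a ^ p\<^sup>2) ^ ?t k)
        (if p - 1 dvd ?t k then of_nat p - 1 else 0)"
      by (rule pcong_le[OF prime pcong_power_sum[OF prime t0]]) simp
    ultimately show "pcong p 1 (\<Sum>a\<in>{0..<int p}. of_int (a ^ p\<^sup>2) ^ ?t k) (if p - 1 dvd ?t k then - 1 else 0)"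
      using pcong_trans prime by blast
  qed
  also have "(\<Sum>k<p. hsum k * (if p - 1 dvd ?t k then - 1 else 0))
     = - (\<Sum>k\<in>{k. k < p \<and> (?t k = p - 1 \<or> ?t k = 2 * (p - 1))}. hsum k)"
  proof -
    have "(\<Sum>k<p. hsum k * (if p - 1 dvd ?t k then - 1 else 0))
       = (\<Sum>k\<in>{k. k < p \<and> (?t k = p - 1 \<or> ?t k = 2 * (p - 1))}. - hsum k)"
      by (rule sum.mono_neutral_cong_right) (use d in auto)
    then show ?thesis by (simp add: sum_negf)
  qed
  finally have 1: "pcong p 1 (\<Sum>k<p. hsum k * (\<Sum>a\<in>{0..<int p}. of_int (a ^ p\<^sup>2) ^ ?t k))
    (- (\<Sum>k\<in>{k. k < p \<and> (?t k = p - 1 \<or> ?t k = 2 * (p - 1))}. hsum k))" .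
  have "pcong p 1 (\<Sum>k\<in>{k. k < p \<and> (?t k = p - 1 \<or> ?t k = 2 * (p - 1))}. hsum k)
    (hsum (nat \<bar>int q - int i\<bar>))"
  proof -
    consider "i < q" | "i = q" | "q < i" by linarith
    then show ?thesis
    proof cases
      case 1
      then have "{k. k < p \<and> (?t k = p - 1 \<or> ?t k = 2 * (p - 1))} = {q - i}"
        using assms n by auto
      moreover have "nat \<bar>int q - int i\<bar> = q - i" using 1 by simp
      moreover have "hsum (q - i) \<in> zp_ring p" using hsum_in_zp_ring[OF prime] assms two_n_plus_1_facts by simp
      then have "pcong p 1 (\<Sum>k\<in>{q - i}. hsum k) (hsum (q - i))" using pcong_refl[OF prime] by simp
      ultimately show ?thesis by (simp only:)
    next
      case 2
      then have "{k. k < p \<and> (?t k = p - 1 \<or> ?t k = 2 * (p - 1))} = {0, p - 1}"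
        using assms n two_n_plus_1_facts by auto
      moreover have "0 \<noteq> p - 1" using two_n_plus_1_facts by simp
      ultimately show ?thesis using hsum_reflect[OF prime two_n_plus_1_facts(1), of 0] two_n_plus_1_facts 2 by simp
    next
      case 3
      then have "{k. k < p \<and> (?t k = p - 1 \<or> ?t k = 2 * (p - 1))} = {p - 1 - (i - q)}"
        using assms n by auto
      moreover have "nat \<bar>int q - int i\<bar> = i - q" using 3 by simp
      moreover have "i - q < p" using assms two_n_plus_1_facts by simp
      then have "pcong p 1 (\<Sum>k\<in>{p - 1 - (i - q)}. hsum k) (hsum (i - q))"
        using hsum_reflect[OF prime two_n_plus_1_facts(1)] by simp
      ultimately show ?thesis by (simp only:)
    qed
  qed
  from pcong_trans[OF 1 pcong_uminus[OF prime this] prime] show ?thesis .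
qed

text \<open>Expanding the Legendre symbol turns the Jacobi sum into power sums. In the leading part
  only \<open>i = q\<close> survives, with the value \<open>p - 1\<close>; the part with the factor
  \<open>p\<close> is needed modulo \<open>p\<close> only and gives
  \<open>binomial_hsum\<close>.\<close>

theorem jacobi_sum_pcong:
  assumes q: "q \<le> n"
  shows "pcong p 2 (of_int (jacobi_sum p (p - 1 - q)))
    ((-1) ^ q * of_nat (n choose q) *
      (of_nat p * (of_nat q * hsum q + of_nat (n - q) * hsum (n - q) - of_nat n * hsum n) - 1))"
proof -
  define R where "R = {0..<int p}"
  define s where "s a = rat_of_int (a ^ p\<^sup>2)" for a
  define K where "K = p - 1 - q"
  define c where "c i = (-1) ^ i * rat_of_nat (n choose i)" for i
  define h where "h a = (\<Sum>k<p. hsum k * s a ^ k)" for a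
  have K: "0 < K" using q n two_n_plus_1_facts by (simp add: K_def)
  have sr: "s a \<in> zp_ring p" for a using prime by (simp add: s_def del: of_int_power)
  have cr: "c i \<in> zp_ring p" for i using prime by (simp add: c_def)
  have expand: "(1 - s a) ^ n = (\<Sum>i\<le>n. c i * s a ^ i)" for a
  proof -
    have "(1 - s a) ^ n = (- s a + 1) ^ n" by simp
    also have "\<dots> = (\<Sum>i\<le>n. of_nat (n choose i) * (- s a) ^ i * 1 ^ (n - i))"
      by (rule binomial_ring)
    also have "\<dots> = (\<Sum>i\<le>n. c i * s a ^ i)"
      by (intro sum.cong refl) (simp add: c_def power_minus[of "s a"])
    finally show ?thesis .
  qed
  define PS where "PS t = (\<Sum>a\<in>R. s a ^ t)" for t
  have J: "of_int (jacobi_sum p K) = (\<Sum>a\<in>R. of_int (Legendre (1 - a) (int p)) * s a ^ K)"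
    by (simp add: jacobi_sum_def R_def s_def power_mult)
  have Leg: "pcong p 2 (\<Sum>a\<in>R. of_int (Legendre (1 - a) (int p)) * s a ^ K)
      (\<Sum>a\<in>R. ((1 - s a) ^ n * (1 - of_nat p * (of_nat n * h a))) * s a ^ K)"
    unfolding h_def s_def
    by (intro pcong_sum pcong_mult Legendre_one_minus_pcong pcong_refl prime zp_ring_power)
      (use prime in \<open>simp del: of_int_power\<close>)
  have exp: "(\<Sum>a\<in>R. ((1 - s a) ^ n * (1 - of_nat p * (of_nat n * h a))) * s a ^ K)
     = (\<Sum>i\<le>n. c i * PS (K + i)) - of_nat p * (of_nat n * (\<Sum>i\<le>n. c i * (\<Sum>k<p. hsum k * PS (K + i + k))))"
  proof -
    have "((1 - s a) ^ n * (1 - of_nat p * (of_nat n * h a))) * s a ^ K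
       = (\<Sum>i\<le>n. c i * s a ^ (K + i)) - of_nat p * (of_nat n * (\<Sum>i\<le>n. c i * (\<Sum>k<p. hsum k * s a ^ (K + i + k))))" for a
    proof -
      have A: "(1 - s a) ^ n * s a ^ K = (\<Sum>i\<le>n. c i * s a ^ (K + i))"
        unfolding expand sum_distrib_right by (intro sum.cong refl) (simp only: power_add mult_ac)
      have "((1 - s a) ^ n * s a ^ K) * h a = (\<Sum>i\<le>n. c i * (\<Sum>k<p. hsum k * s a ^ (K + i + k)))"
        unfolding A h_def unfolding sum_product unfolding sum_distrib_left
        by (intro sum.cong refl) (simp only: power_add mult_ac)
      then show ?thesis unfolding A[symmetric] by (simp add: algebra_simps)
    qed
    moreover have "(\<Sum>a\<in>R. \<Sum>i\<le>n. c i * s a ^ (K + i)) = (\<Sum>i\<le>n. c i * PS (K + i))"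
      unfolding PS_def sum_distrib_left by (rule sum.swap)
    moreover have "(\<Sum>a\<in>R. \<Sum>i\<le>n. c i * (\<Sum>k<p. hsum k * s a ^ (K + i + k)))
       = (\<Sum>i\<le>n. c i * (\<Sum>k<p. hsum k * PS (K + i + k)))"
    proof -
      have "(\<Sum>a\<in>R. \<Sum>i\<le>n. c i * (\<Sum>k<p. hsum k * s a ^ (K + i + k)))
        = (\<Sum>i\<le>n. \<Sum>a\<in>R. c i * (\<Sum>k<p. hsum k * s a ^ (K + i + k)))" by (rule sum.swap)
      also have "\<dots> = (\<Sum>i\<le>n. c i * (\<Sum>a\<in>R. \<Sum>k<p. hsum k * s a ^ (K + i + k)))"
        by (simp only: sum_distrib_left)
      also have "(\<lambda>i. \<Sum>a\<in>R. \<Sum>k<p. hsum k * s a ^ (K + i + k)) = (\<lambda>i. \<Sum>k<p. \<Sum>a\<in>R. hsum k * s a ^ (K + i + k))"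
        by (rule ext) (rule sum.swap)
      finally show ?thesis unfolding PS_def by (simp only: sum_distrib_left)
    qed
    ultimately show ?thesis
      by (simp only: sum_subtractf sum_distrib_left[symmetric])
  qed
  have main: "pcong p 2 (\<Sum>i\<le>n. c i * PS (K + i)) (c q * (of_nat p - 1))"
  proof -
    have "pcong p 2 (\<Sum>i\<le>n. c i * PS (K + i)) (\<Sum>i\<le>n. c i * (if p - 1 dvd K + i then of_nat p - 1 else 0))"
      unfolding PS_def s_def R_def
      by (intro pcong_sum pcong_mult pcong_refl cr prime pcong_power_sum) (use K in simp)
    also have "(\<Sum>i\<le>n. c i * (if p - 1 dvd K + i then of_nat p - 1 else 0)) = (\<Sum>i\<le>n. if i = q then c i * (of_nat p - 1) else 0)"
    proof (rule sum.cong[OF refl])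
      fix i assume i: "i \<in> {..n}"
      have "p - 1 dvd K + i \<longleftrightarrow> i = q"
      proof
        assume "p - 1 dvd K + i"
        then have "K + i = p - 1 \<or> K + i = 2 * (p - 1)"
          by (rule dvd_small_multiple) (use i K n q in \<open>auto simp: K_def\<close>)
        then show "i = q" using i q n two_n_plus_1_facts by (auto simp: K_def)
      qed (use q n in \<open>simp add: K_def\<close>)
      then show "c i * (if p - 1 dvd K + i then of_nat p - 1 else 0) = (if i = q then c i * (of_nat p - 1) else 0)"
        by simp
    qed
    also have "\<dots> = c q * (of_nat p - 1)" using q by simp
    finally show ?thesis .
  qed
  have corr: "pcong p 2 (of_nat p * (of_nat n * (\<Sum>i\<le>n. c i * (\<Sum>k<p. hsum k * PS (K + i + k)))))
     (of_nat p * (- (of_nat n * binomial_hsum n q)))"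
  proof -
    have "pcong p 1 (\<Sum>i\<le>n. c i * (\<Sum>k<p. hsum k * PS (K + i + k))) (\<Sum>i\<le>n. c i * (- hsum (nat \<bar>int q - int i\<bar>)))"
      unfolding PS_def s_def R_def K_def
      by (intro pcong_sum pcong_mult pcong_refl cr prime hsum_power_sum q) simp
    also have "(\<Sum>i\<le>n. c i * (- hsum (nat \<bar>int q - int i\<bar>))) = - binomial_hsum n q"
      by (simp add: binomial_hsum_def c_def sum_negf)
    finally have "pcong p 1 (\<Sum>i\<le>n. c i * (\<Sum>k<p. hsum k * PS (K + i + k))) (- binomial_hsum n q)" .
    then have "pcong p 1 (of_nat n * (\<Sum>i\<le>n. c i * (\<Sum>k<p. hsum k * PS (K + i + k)))) (of_nat n * (- binomial_hsum n q))"
      using prime by (intro pcong_mult pcong_refl) auto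
    from pcong_mult_p[OF prime this] show ?thesis by (simp only: Suc_1 mult_minus_right)
  qed
  have "pcong p 2 (of_int (jacobi_sum p K)) (c q * (of_nat p - 1) - of_nat p * (- (of_nat n * binomial_hsum n q)))"
    unfolding J by (rule pcong_trans[OF Leg[unfolded exp] pcong_diff[OF prime main corr] prime])
  \<comment> \<open>The \<open>- 1\<close> in the closed form of \<open>binomial_hsum\<close>
    cancels the \<open>p\<close> of \<open>p - 1\<close>.\<close>
  also have "c q * (of_nat p - 1) - of_nat p * (- (of_nat n * binomial_hsum n q))
     = c q * (of_nat p * (of_nat q * hsum q + of_nat (n - q) * hsum (n - q) - of_nat n * hsum n) - 1)"
    unfolding binomial_hsum_eq[OF two_n_plus_1_facts(5) q] c_def by (simp add: algebra_simps)
  finally show ?thesis unfolding K_def c_def .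
qed

end

section \<open>Comparison of the two sums with the Jacobi sum\<close>

theorem theorem4p2:
  fixes p :: nat and x y :: int
  assumes "prime p"
    and "[p = 1] (mod 3)"
    and "int p = x\<^sup>2 + 3 * y\<^sup>2"
  shows "zp_cong p
           (\<Sum>k = 0..p - 1. (of_nat ((2 * k) choose k))\<^sup>2 * (1 / 16 ^ k) * (of_nat p / of_nat (3 * k + 1)))
           (\<Sum>k = 0..p - 1. (of_nat ((2 * k) choose k))\<^sup>2 * (1 / 16 ^ k) * (of_nat p / of_nat (6 * k + 1)))
           ((of_nat p)\<^sup>2)
       \<and> zp_cong p
           (\<Sum>k = 0..p - 1. (of_nat ((2 * k) choose k))\<^sup>2 * (1 / 16 ^ k) * (of_nat p / of_nat (6 * k + 1)))
           (of_int (4 * x\<^sup>2 - 2 * int p))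
           ((of_nat p)\<^sup>2)"
proof -
  note prime = assms(1)
  have p1: "1 < p" using prime prime_gt_1_nat by blast
  have mod3: "p mod 3 = 1" using assms(2) by (simp add: cong_def)
  then have "p \<noteq> 2" by auto
  then have "odd p" using prime prime_odd_nat[of p] p1 by auto
  define r where "r = p div 6"
  have r: "p = 6 * r + 1" using mod3 \<open>odd p\<close> unfolding r_def by presburger
  have r0: "0 < r" using r p1 by simp
  \<comment> \<open>As \<open>q + r = n\<close>, the denominators 3 and 6 lead to
    \<open>m = q\<close> and \<open>m = r\<close> with the same binomial coefficient.\<close>
  define q n where "q = 2 * r" and "n = 3 * r"
  have n: "p = 2 * n + 1" and q: "q \<le> n" and rn: "r \<le> n" and nq: "n - q = r" "n - r = q"
    using r by (auto simp: q_def n_def)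
  have np: "n < p" "q < p" "r < p" using r r0 by (auto simp: q_def n_def)
  define C where "C = rat_of_nat (n choose q)"
  have C': "rat_of_nat (n choose r) = C" using binomial_symmetric[OF q] nq by (simp add: C_def)
  have Cr: "C \<in> zp_ring p" using prime by (simp add: C_def)
  note h = hsum_in_zp_ring[OF prime np(1)] hsum_in_zp_ring[OF prime np(2)] hsum_in_zp_ring[OF prime np(3)]
  \<comment> \<open>The common coefficient of \<open>p\<close>: exchanging \<open>q\<close> and
    \<open>r\<close> while passing from \<open>2 / 3\<close> to \<open>2 / 6\<close> leaves it
    unchanged.\<close>
  define W where "W = 2 / 3 * hsum q + 1 / 3 * hsum r - hsum n"
  have ndvd3: "\<not> p dvd 3" using r r0 by (auto dest: dvd_imp_le)
  have div3: "u / 3 \<in> zp_ring p" if "u \<in> zp_ring p" for u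
    using zp_ring_divide_nat[OF prime that ndvd3] by simp
  have Wr: "W \<in> zp_ring p" unfolding W_def
    using h prime by (intro zp_ring_diff zp_ring_add zp_ring_mult div3) auto
  define V where "V = C\<^sup>2 * (1 + of_nat p * W)"
  let ?S = "\<lambda>d. \<Sum>k=0..p - 1. (rat_of_nat ((2 * k) choose k))\<^sup>2 * (1 / 16 ^ k) * (of_nat p / of_nat (d * k + 1))"
  have S3: "pcong p 2 (?S 3) V"
  proof -
    have "p = 3 * q + 1" using r by (simp add: q_def)
    from sum_central_binomial_pcong[OF prime n this q]
    have "pcong p 2 (?S 3) (C\<^sup>2 * (1 + of_nat p * (hsum r - hsum n + 2 / of_nat 3 * (hsum q - hsum r))))"
      unfolding nq C_def .
    moreover have "hsum r - hsum n + 2 / of_nat 3 * (hsum q - hsum r) = W"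
      by (simp add: W_def field_simps)
    ultimately show ?thesis by (simp only: V_def)
  qed
  have S6: "pcong p 2 (?S 6) V"
  proof -
    from sum_central_binomial_pcong[OF prime n r rn]
    have "pcong p 2 (?S 6) (C\<^sup>2 * (1 + of_nat p * (hsum q - hsum n + 2 / of_nat 6 * (hsum r - hsum q))))"
      unfolding nq C' .
    moreover have "hsum q - hsum n + 2 / of_nat 6 * (hsum r - hsum q) = W"
      by (simp add: W_def field_simps)
    ultimately show ?thesis by (simp only: V_def)
  qed
  define J1 J2 where "J1 = jacobi_sum p (2 * r)" and "J2 = jacobi_sum p (4 * r)"
  define E where "E = of_nat q * hsum q + of_nat r * hsum r - of_nat n * hsum n"
  have Er: "E \<in> zp_ring p" unfolding E_def using h prime by auto
  have "p - 1 - q = 4 * r" using r by (simp add: q_def)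
  then have J2: "pcong p 2 (of_int J2) (C * (of_nat p * E - 1))"
  proof -
    assume e: "p - 1 - q = 4 * r"
    have s: "(-1::rat) ^ q = 1" by (simp add: q_def)
    show ?thesis
      using jacobi_sum_pcong[OF prime n q, unfolded e nq s mult_1] unfolding J2_def C_def E_def .
  qed
  have pr: "rat_of_nat p = 6 * of_nat r + 1" by (subst r) simp
  have J2sq: "pcong p 2 ((of_int J2)\<^sup>2) V"
  proof -
    have "pcong p 2 ((of_int J2)\<^sup>2) ((C * (of_nat p * E - 1))\<^sup>2)" by (rule pcong_power[OF prime J2])
    also have "pcong p 2 ((C * (of_nat p * E - 1))\<^sup>2) V"
    proof (rule pcongI[OF prime])
      show "V \<in> zp_ring p" unfolding V_def using Cr Wr prime by simp
      \<comment> \<open>Because \<open>2 * q\<close>, \<open>2 * r\<close> and \<open>2 * n\<close>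
        are \<open>2 / 3\<close>, \<open>1 / 3\<close> and 1 times \<open>p - 1\<close>, the number
        \<open>- 2 * E\<close> equals \<open>(1 - p) * W\<close>. Thus \<open>G\<close> is
        \<open>- W\<close>.\<close>
      define G where "G = hsum n - 2 / 3 * hsum q - 1 / 3 * hsum r"
      have G: "- 2 * E - W = of_nat p * G"
        unfolding E_def W_def G_def pr by (simp add: q_def n_def algebra_simps)
      have "(C * (of_nat p * E - 1))\<^sup>2 - V = C\<^sup>2 * (of_nat p * (- 2 * E - W) + (of_nat p)\<^sup>2 * E\<^sup>2)"
        unfolding power_mult_distrib V_def by (simp add: power2_eq_square algebra_simps)
      also have "\<dots> = (of_nat p)\<^sup>2 * (C\<^sup>2 * (G + E\<^sup>2))"
        unfolding G by (simp add: power2_eq_square algebra_simps)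
      finally show "(C * (of_nat p * E - 1))\<^sup>2 = V + (of_nat p)\<^sup>2 * (C\<^sup>2 * (G + E\<^sup>2))"
        by (simp add: algebra_simps)
      have "G \<in> zp_ring p" unfolding G_def
        using h prime by (intro zp_ring_diff zp_ring_mult div3) auto
      then show "C\<^sup>2 * (G + E\<^sup>2) \<in> zp_ring p" using Cr Er prime by simp
    qed
    finally show ?thesis using prime .
  qed
  \<comment> \<open>Modulo \<open>p\<close> this Jacobi sum is \<open>- C\<close>, a binomial
    coefficient with upper index below \<open>p\<close>. The factor \<open>p\<close> of the product
    of the two sums therefore lies in \<open>J1\<close>.\<close>
  have J2_unit: "\<not> int p dvd J2"
  proof
    assume "int p dvd J2"
    then have "[J2 = 0] (mod int p ^ 1)" by (simp add: cong_0_iff)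
    from pcong_of_int[OF prime this] have 1: "pcong p 1 (of_int J2) 0" by simp
    have "pcong p 1 (of_int J2) (C * (of_nat p * E - 1))" by (rule pcong_le[OF prime J2]) simp
    moreover have "pcong p 1 (C * (of_nat p * E - 1)) (- C)"
      by (rule pcongI[OF prime, of _ "C * E"]) (use Cr Er prime in \<open>auto simp: algebra_simps\<close>)
    ultimately have "pcong p 1 0 (- C)" using 1 pcong_trans pcong_sym prime by metis
    from pcong_uminus[OF prime this] have "pcong p 1 0 C" by simp
    then obtain e where e: "e \<in> zp_ring p" "0 = C + of_nat p ^ 1 * e" by (elim pcongE)
    obtain a b where ab: "\<not> int p dvd b" "e = of_int a / of_int b"
      using e(1) zp_ring_iff[OF prime] by auto
    then have "b \<noteq> 0" by auto
    then have "rat_of_int (int (n choose q) * b) = of_int (- (int p * a))"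
      using e(2) ab(2) by (simp add: C_def field_simps add_eq_0_iff)
    then have "int (n choose q) * b = - (int p * a)" by linarith
    then have "int p dvd int (n choose q) * b" by simp
    then have "p dvd n choose q" using ab(1) prime by (simp add: prime_dvd_mult_iff)
    then have "p dvd fact n" using binomial_fact_lemma[OF q] by (metis dvd_mult)
    then show False using np prime by (simp add: prime_dvd_fact_iff)
  qed
  obtain X Y where XY: "int p = X\<^sup>2 + 3 * Y\<^sup>2" "[J2 + J1 = 2 * X] (mod int p ^ 3)"
    using jacobi_sum_add[OF prime r r0] unfolding J1_def J2_def by blast
  have X: "X\<^sup>2 = x\<^sup>2" by (rule prime_repr_unique[OF prime assms(3) XY(1)])
  have norm: "[J2 * J1 = int p] (mod int p ^ 3)"
    using jacobi_sum_mult[OF prime r r0] by (simp add: J1_def J2_def)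
  have "[J2 * J1 = int p] (mod int p)" using norm by (rule cong_dvd_modulus) (simp add: dvd_power)
  then have "int p dvd J2 * J1" using cong_dvd_iff dvd_refl by blast
  then have J1: "int p dvd J1" using J2_unit prime by (simp add: prime_dvd_mult_iff)
  have down: "[u = v] (mod (int p)\<^sup>2)" if "[u = v] (mod int p ^ 3)" for u v
    using that by (rule cong_dvd_modulus) (simp add: le_imp_power_dvd)
  \<comment> \<open>The left side is \<open>J1^2 + J2^2\<close>, and \<open>p^2\<close> divides
    \<open>J1^2\<close>.\<close>
  have "[(J2 + J1) * (J2 + J1) - 2 * (J2 * J1) = 2 * X * (2 * X) - 2 * int p] (mod (int p)\<^sup>2)"
    by (intro cong_diff cong_mult cong_refl down XY norm)
  moreover have "[(J2 + J1) * (J2 + J1) - 2 * (J2 * J1) = J2\<^sup>2] (mod (int p)\<^sup>2)"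
  proof -
    have "(J2 + J1) * (J2 + J1) - 2 * (J2 * J1) - J2\<^sup>2 = J1\<^sup>2" by (simp add: power2_eq_square algebra_simps)
    then show ?thesis unfolding cong_iff_dvd_diff using J1 by simp
  qed
  moreover have "2 * X * (2 * X) - 2 * int p = 4 * x\<^sup>2 - 2 * int p"
    unfolding X[symmetric] by (simp add: power2_eq_square)
  ultimately have "[J2\<^sup>2 = 4 * x\<^sup>2 - 2 * int p] (mod (int p)\<^sup>2)"
    using cong_sym cong_trans by metis
  from pcong_of_int[OF prime this]
  have J2x: "pcong p 2 ((of_int J2)\<^sup>2) (of_int (4 * x\<^sup>2 - 2 * int p))" by simp
  have VJ: "pcong p 2 V ((of_int J2)\<^sup>2)" by (rule pcong_sym[OF prime J2sq])
  have "pcong p 2 (?S 3) (?S 6)"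
    by (rule pcong_trans[OF S3 pcong_sym[OF prime S6] prime])
  moreover have "pcong p 2 (?S 6) (of_int (4 * x\<^sup>2 - 2 * int p))"
    by (rule pcong_trans[OF S6 pcong_trans[OF VJ J2x prime] prime])
  ultimately show ?thesis unfolding pcong_def by blast
qed

end
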